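(* Let $P_{\bar d}$ be any probability distribution on $[0,+\infty]$ and let $\mu_s$ be any symmetric probability distribution on $(-\infty,+\infty]$. Let $\mathcal{Q}_L$ be the associated large-degree BP operator on LLR distributions, and call an LLR distribution $\mu$ a BP fixed point if $\mathcal{Q}_L\mu=\mu$. 1. There is at most one non-trivial BP fixed point, and it is symmetric. 2. A non-trivial symmetric BP fixed point exists if and only if either $\mathbb{E}[\bar d]\in(1,+\infty]$ (with $\bar d\sim P_{\bar d}$) or $\mu_s$ is non-trivial. 3. For every non-trivial LLR distribution $\mu$, the sequence $\mathcal{Q}_L^h\mu$ converges weakly as $h\to\infty$ to the unique non-trivial BP fixed point if it exists, and to the trivial distribution $\delta_0$ otherwise. 4. If $\mu_s$ is non-trivial, the convergence statement in 3 also holds for the trivial initialization $\mu=\delta_0$.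
   Context: A probability distribution $\mu$ on $(-\infty,+\infty]$ is symmetric if $\mu[E]=\int e^{-r}\mathbf{1}\{-r\in E\}\,d\mu(r)$ for every measurable $E\subseteq(-\infty,+\infty)$. The trivial distribution is $\delta_0$, the unit mass at $0$. Weak convergence is that of probability measures on $(-\infty,+\infty]$. A probability distribution $\mu$ on $(-\infty,+\infty]$ is an LLR distribution if $\int e^{-r}d\mu(r)\le 1$; its complement is the (unique) probability distribution $\mu^-$ on $[-\infty,+\infty)$ with $\mu^-[E]=\int e^{-r}\mathbf{1}\{r\in E\}\,d\mu(r)$ for every measurable $E\subseteq(-\infty,+\infty)$. Symmetric distributions are LLR distributions. Operator: for an LLR distribution $\mu$ let $V_\mu=\mathbb{E}_{R\sim\frac12(\mu+\mu^-)}\big[4\tanh^2(R/2)\big]$ (for symmetric $\mu$ this equals $\mathbb{E}_{R\sim\mu}[4\tanh(R/2)]$). For $s\in[0,+\infty]$ let $\mathcal{N}(s)$ be the Gaussian distribution with mean $s/2$ and variance $s$, with $\mathcal{N}(0)=\delta_0$ and $\mathcal{N}(+\infty)$ the unit mass at $+\infty$. Then $$\mathcal{Q}_L\mu=\mathbb{E}_{\bar d\sim P_{\bar d}}\big[\mathcal{N}(\bar d\cdot V_\mu)\big]*\mu_s,$$ where the expectation denotes the mixture of distributions over the law of $\bar d$, $*$ is convolution (law of the sum of independent variables), and $(+\infty)\cdot 0=0$. *)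

theory Defs
  imports "HOL-Probability.Probability"
begin

text \<open>
  Distributions on \<open>(-\<infinity>,+\<infinity>]\<close> are Borel probability measures on \<^typ>\<open>ereal\<close> that give no mass
  to \<open>-\<infinity>\<close>; the complement of such a distribution lives on \<open>[-\<infinity>,+\<infinity>)\<close>, inside the same type.
\<close>

definition llr_line_dist :: "ereal measure \<Rightarrow> bool" where
  "llr_line_dist \<mu> \<longleftrightarrow> prob_space \<mu> \<and> sets \<mu> = sets borel \<and> emeasure \<mu> {-\<infinity>} = 0"

definition exp_neg :: "ereal \<Rightarrow> ennreal" where
  "exp_neg r = (if r = \<infinity> then 0 else if r = -\<infinity> then \<infinity> else ennreal (exp (- real_of_ereal r)))"

definition symmetric_dist :: "ereal measure \<Rightarrow> bool" where
  "symmetric_dist \<mu> \<longleftrightarrow> llr_line_dist \<mu> \<and>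
     (\<forall>E\<in>sets borel. E \<subseteq> {-\<infinity><..<\<infinity>} \<longrightarrow>
        emeasure \<mu> E = (\<integral>\<^sup>+ r. exp_neg r * indicator E (- r) \<partial>\<mu>))"

definition LLR_dist :: "ereal measure \<Rightarrow> bool" where
  "LLR_dist \<mu> \<longleftrightarrow> llr_line_dist \<mu> \<and> (\<integral>\<^sup>+ r. exp_neg r \<partial>\<mu>) \<le> 1"

definition trivial_dist :: "ereal measure" where
  "trivial_dist = return borel 0"

definition is_complement :: "ereal measure \<Rightarrow> ereal measure \<Rightarrow> bool" where
  "is_complement \<mu> \<nu> \<longleftrightarrow> prob_space \<nu> \<and> sets \<nu> = sets borel \<and> emeasure \<nu> {\<infinity>} = 0 \<and>
     (\<forall>E\<in>sets borel. E \<subseteq> {-\<infinity><..<\<infinity>} \<longrightarrow>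
        emeasure \<nu> E = (\<integral>\<^sup>+ r. exp_neg r * indicator E r \<partial>\<mu>))"

definition complement_dist :: "ereal measure \<Rightarrow> ereal measure" where
  "complement_dist \<mu> = (THE \<nu>. is_complement \<mu> \<nu>)"

definition tanh_ereal :: "ereal \<Rightarrow> real" where
  "tanh_ereal r = (if r = \<infinity> then 1 else if r = -\<infinity> then -1 else tanh (real_of_ereal r))"

text \<open>The mixture \<open>(\<mu> + \<mu>\<^sup>-) / 2\<close>.\<close>

definition half_mix :: "ereal measure \<Rightarrow> ereal measure" where
  "half_mix \<mu> = measure_pmf (bernoulli_pmf (1/2)) \<bind> (\<lambda>b. if b then \<mu> else complement_dist \<mu>)"

definition V_of :: "ereal measure \<Rightarrow> ennreal" where
  "V_of \<mu> = (\<integral>\<^sup>+ r. ennreal (4 * (tanh_ereal (r / 2))\<^sup>2) \<partial>half_mix \<mu>)"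

text \<open>\<^const>\<open>normal_density\<close> takes the mean and the standard deviation.\<close>

definition gaussian_llr :: "ennreal \<Rightarrow> ereal measure" where
  "gaussian_llr s =
     (if s = 0 then return borel 0
      else if s = \<infinity> then return borel \<infinity>
      else distr (density lborel (normal_density (enn2real s / 2) (sqrt (enn2real s)))) borel ereal)"

definition conv_ereal :: "ereal measure \<Rightarrow> ereal measure \<Rightarrow> ereal measure" where
  "conv_ereal M N = distr (M \<Otimes>\<^sub>M N) borel (\<lambda>(x, y). x + y)"

definition Q_L :: "ennreal measure \<Rightarrow> ereal measure \<Rightarrow> ereal measure \<Rightarrow> ereal measure" where
  "Q_L P \<mu>s \<mu> = conv_ereal (P \<bind> (\<lambda>d. gaussian_llr (d * V_of \<mu>))) \<mu>s"

definition BP_fixed_point :: "ennreal measure \<Rightarrow> ereal measure \<Rightarrow> ereal measure \<Rightarrow> bool" where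
  "BP_fixed_point P \<mu>s \<mu> \<longleftrightarrow> LLR_dist \<mu> \<and> Q_L P \<mu>s \<mu> = \<mu>"

text \<open>
  Weak convergence on the space \<open>(-\<infinity>,+\<infinity>]\<close>: a test function need not have a limit at \<open>-\<infinity>\<close>,
  so continuity and boundedness are only required on that subspace.
\<close>

definition weak_conv_llr :: "(nat \<Rightarrow> ereal measure) \<Rightarrow> ereal measure \<Rightarrow> bool" where
  "weak_conv_llr M_seq M \<longleftrightarrow>
     (\<forall>f :: ereal \<Rightarrow> real. continuous_on {-\<infinity><..} f \<longrightarrow> bounded (f ` {-\<infinity><..}) \<longrightarrow>
        (\<lambda>n. LINT x:{-\<infinity><..}|M_seq n. f x) \<longlonglongrightarrow> (LINT x:{-\<infinity><..}|M. f x))"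

lemma exp_neg_measurable [measurable]: "exp_neg \<in> borel_measurable borel"
  unfolding exp_neg_def[abs_def] by measurable

lemma complement_ex1:
  assumes "LLR_dist \<mu>"
  shows "\<exists>!\<nu>. is_complement \<mu> \<nu>"
proof -
  have sets_mu[measurable_cong]: "sets \<mu> = sets borel" and le1: "(\<integral>\<^sup>+ r. exp_neg r \<partial>\<mu>) \<le> 1"
    and mneg: "emeasure \<mu> {-\<infinity>} = 0"
    using assms by (auto simp: LLR_dist_def llr_line_dist_def)
  have space_mu: "space \<mu> = UNIV" using sets_eq_imp_space_eq[OF sets_mu] by simp
  let ?D = "density \<mu> exp_neg"
  let ?R = "return borel (-\<infinity>) :: ereal measure"
  define c where "c = 1 - (\<integral>\<^sup>+ r. exp_neg r \<partial>\<mu>)"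
  define g where "g E = emeasure ?D E + c * emeasure ?R E" for E
  define \<nu> where "\<nu> = measure_of UNIV (sets borel) g"
  have D_eq: "emeasure ?D E = (\<integral>\<^sup>+ r. exp_neg r * indicator E r \<partial>\<mu>)" if "E \<in> sets borel" for E
    using that sets_mu by (subst emeasure_density) auto
  have ca: "countably_additive (sets borel) g"
  proof (rule countably_additiveI)
    fix A :: "nat \<Rightarrow> ereal set"
    assume A: "range A \<subseteq> sets borel" "disjoint_family A" "(\<Union>i. A i) \<in> sets borel"
    have "(\<Sum>i. g (A i)) = (\<Sum>i. emeasure ?D (A i)) + c * (\<Sum>i. emeasure ?R (A i))"
      unfolding g_def by (subst suminf_add[symmetric]) (auto simp: ennreal_suminf_cmult)
    also have "\<dots> = g (\<Union>i. A i)"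
      unfolding g_def using A sets_mu by (subst (1 2) suminf_emeasure) auto
    finally show "(\<Sum>i. g (A i)) = g (\<Union>i. A i)" .
  qed
  have pos: "positive (sets borel) g"
    by (auto simp: positive_def g_def)
  have sets_nu: "sets \<nu> = sets borel"
    unfolding \<nu>_def by (metis sets.sets_measure_of_eq space_borel)
  have em: "emeasure \<nu> E = g E" if "E \<in> sets borel" for E
    unfolding \<nu>_def
    by (rule emeasure_measure_of_sigma) 
       (use that ca pos sets.sigma_algebra_axioms[of "borel :: ereal measure"] in auto)
  have "g UNIV = (\<integral>\<^sup>+ r. exp_neg r \<partial>\<mu>) + c"
    unfolding g_def by (subst D_eq) auto
  then have tot: "g UNIV = 1"
    unfolding c_def using le1 by (simp add: add_diff_eq_iff_ennreal ennreal_add_diff_cancel_left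
       add_diff_inverse_ennreal)
  have sp_nu: "space \<nu> = UNIV" using sets_eq_imp_space_eq[OF sets_nu] by simp
  have "is_complement \<mu> \<nu>"
    unfolding is_complement_def
  proof (intro conjI ballI impI)
    show "prob_space \<nu>" by (rule prob_spaceI) (simp add: sp_nu em tot)
    show "sets \<nu> = sets borel" by fact
    have "(\<integral>\<^sup>+ r. exp_neg r * indicator {\<infinity>} r \<partial>\<mu>) = (\<integral>\<^sup>+ r. 0 \<partial>\<mu>)"
      by (intro nn_integral_cong) (auto simp: exp_neg_def indicator_def)
    then show "emeasure \<nu> {\<infinity>} = 0" by (simp add: em g_def D_eq)
  next
    fix E :: "ereal set" assume E: "E \<in> sets borel" "E \<subseteq> {-\<infinity><..<\<infinity>}"
    then have "-\<infinity> \<notin> E" by auto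
    with E show "emeasure \<nu> E = (\<integral>\<^sup>+ r. exp_neg r * indicator E r \<partial>\<mu>)"
      by (simp add: em g_def D_eq)
  qed
  moreover have "\<nu>1 = \<nu>2" if "is_complement \<mu> \<nu>1" "is_complement \<mu> \<nu>2" for \<nu>1 \<nu>2
  proof (rule measure_eqI)
    interpret p1: prob_space \<nu>1 using that by (simp add: is_complement_def)
    interpret p2: prob_space \<nu>2 using that by (simp add: is_complement_def)
    have s: "sets \<nu>1 = sets borel" "sets \<nu>2 = sets borel"
      using that by (auto simp: is_complement_def)
    have sp: "space \<nu>1 = UNIV" "space \<nu>2 = UNIV"
      using s[THEN sets_eq_imp_space_eq] by auto
    show "sets \<nu>1 = sets \<nu>2" using s by simp
    let ?F = "{-\<infinity><..<\<infinity>} :: ereal set"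
    have z: "emeasure \<nu>1 {\<infinity>} = 0" "emeasure \<nu>2 {\<infinity>} = 0"
      using that by (auto simp: is_complement_def)
    have fin: "emeasure \<nu>1 E = emeasure \<nu>2 E" if "E \<in> sets borel" "E \<subseteq> ?F" for E
      using that \<open>is_complement \<mu> \<nu>1\<close> \<open>is_complement \<mu> \<nu>2\<close> by (simp add: is_complement_def)
    have U: "UNIV = ?F \<union> ({\<infinity>} \<union> {-\<infinity>})" by (auto simp: less_top[symmetric])
    have minf: "emeasure \<nu> {-\<infinity>} = 1 - emeasure \<nu> ?F"
      if "prob_space \<nu>" "sets \<nu> = sets borel" "emeasure \<nu> {\<infinity>} = 0" for \<nu> :: "ereal measure"
    proof -
      interpret prob_space \<nu> by fact
      have spn: "space \<nu> = UNIV" using that(2)[THEN sets_eq_imp_space_eq] by simp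
      have "1 = emeasure \<nu> (?F \<union> ({\<infinity>} \<union> {-\<infinity>}))" using emeasure_space_1 U spn by simp
      also have "\<dots> = emeasure \<nu> ?F + emeasure \<nu> ({\<infinity>} \<union> {-\<infinity>})"
        by (rule plus_emeasure[symmetric]) (use that(2) in auto)
      also have "emeasure \<nu> ({\<infinity>} \<union> {-\<infinity>}) = emeasure \<nu> {\<infinity>} + emeasure \<nu> {-\<infinity>}"
        by (rule plus_emeasure[symmetric]) (use that(2) in auto)
      finally have "1 = emeasure \<nu> ?F + emeasure \<nu> {-\<infinity>}" using that(3) by simp
      then show ?thesis by (metis emeasure_finite ennreal_add_diff_cancel_left infinity_ennreal_def)
    qed
    fix E assume "E \<in> sets \<nu>1"
    then have E: "E \<in> sets borel" using s by simp
    have split: "emeasure \<nu> E = emeasure \<nu> (E \<inter> ?F) + (emeasure \<nu> (E \<inter> {\<infinity>}) + emeasure \<nu> (E \<inter> {-\<infinity>}))"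
      if "sets \<nu> = sets borel" for \<nu> :: "ereal measure"
    proof -
      have "emeasure \<nu> E = emeasure \<nu> ((E \<inter> ?F) \<union> ((E \<inter> {\<infinity>}) \<union> (E \<inter> {-\<infinity>})))"
        using U by (metis Int_Un_distrib Int_UNIV_right)
      also have "\<dots> = emeasure \<nu> (E \<inter> ?F) + emeasure \<nu> ((E \<inter> {\<infinity>}) \<union> (E \<inter> {-\<infinity>}))"
        by (rule plus_emeasure[symmetric]) (use that E in auto)
      also have "emeasure \<nu> ((E \<inter> {\<infinity>}) \<union> (E \<inter> {-\<infinity>})) = emeasure \<nu> (E \<inter> {\<infinity>}) + emeasure \<nu> (E \<inter> {-\<infinity>})"
        by (rule plus_emeasure[symmetric]) (use that E in auto)
      finally show ?thesis .
    qed
    have "emeasure \<nu>1 (E \<inter> {\<infinity>}) = emeasure \<nu>2 (E \<inter> {\<infinity>})"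
      using z by (cases "\<infinity> \<in> E") auto
    moreover have "emeasure \<nu>1 {-\<infinity>} = emeasure \<nu>2 {-\<infinity>}"
      using minf[OF p1.prob_space_axioms s(1) z(1)] minf[OF p2.prob_space_axioms s(2) z(2)]
        fin[of ?F] by simp
    then have "emeasure \<nu>1 (E \<inter> {-\<infinity>}) = emeasure \<nu>2 (E \<inter> {-\<infinity>})"
      by (cases "-\<infinity> \<in> E") auto
    ultimately show "emeasure \<nu>1 E = emeasure \<nu>2 E"
      using split[OF s(1)] split[OF s(2)] fin[of "E \<inter> ?F"] E by simp
  qed
  ultimately show ?thesis by blast
qed

lemma is_complement_complement_dist:
  "LLR_dist \<mu> \<Longrightarrow> is_complement \<mu> (complement_dist \<mu>)"
  unfolding complement_dist_def by (rule theI') (rule complement_ex1)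

lemma gaussian_llr_measurable [measurable]:
  "gaussian_llr \<in> borel \<rightarrow>\<^sub>M subprob_algebra borel"
proof -
  let ?G = "\<lambda>s. distr (density lborel (normal_density (enn2real s / 2) (sqrt (enn2real s)))) borel ereal"
  have ps: "prob_space (gaussian_llr s)" for s
  proof (cases "s = 0 \<or> s = \<infinity>")
    case True
    then show ?thesis by (auto simp: gaussian_llr_def intro!: prob_space_return)
  next
    case False
    then have "0 < enn2real s" by (auto simp: enn2real_positive_iff less_top zero_less_iff_neq_zero)
    then have "prob_space (density lborel (normal_density (enn2real s / 2) (sqrt (enn2real s))))"
      by (intro prob_space_normal_density) simp
    then have "prob_space (?G s)" by (rule prob_space.prob_space_distr) simp
    then show ?thesis using False by (simp add: gaussian_llr_def)
  qed
  show ?thesis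
  proof (rule measurable_subprob_algebra)
    show "subprob_space (gaussian_llr s)" for s
      using ps by (rule prob_space_imp_subprob_space)
    show "sets (gaussian_llr s) = sets borel" for s
      by (simp add: gaussian_llr_def)
    fix A :: "ereal set" assume [measurable]: "A \<in> sets borel"
    have "emeasure (?G s) A =
        (\<integral>\<^sup>+ x. ennreal (normal_density (enn2real s / 2) (sqrt (enn2real s)) x) * indicator A (ereal x) \<partial>lborel)" for s
    proof -
      have "ereal -` A \<in> sets lborel"
        using measurable_sets[of ereal lborel borel A] by simp
      then show ?thesis
        by (subst emeasure_distr) (auto simp: emeasure_density indicator_def intro!: nn_integral_cong)
    qed
    moreover have "(\<lambda>s. \<integral>\<^sup>+ x. ennreal (normal_density (enn2real s / 2) (sqrt (enn2real s)) x) *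
        indicator A (ereal x) \<partial>lborel) \<in> borel_measurable borel"
      unfolding normal_density_def by measurable
    ultimately have "(\<lambda>s. emeasure (?G s) A) \<in> borel_measurable borel"
      by simp
    moreover have "(\<lambda>s. emeasure (gaussian_llr s) A) =
       (\<lambda>s. if s = 0 then indicator A 0 else if s = \<infinity> then indicator A \<infinity> else emeasure (?G s) A)"
      by (auto simp: gaussian_llr_def fun_eq_iff)
    ultimately show "(\<lambda>s. emeasure (gaussian_llr s) A) \<in> borel_measurable borel"
      by simp
  qed
qed

end

theory Submission
  imports Defs
begin

text \<open>
  The operator sees an LLR distribution \<open>\<mu>\<close> only through the number \<open>V\<^sub>\<mu>\<close>: it returns the law
  \<open>\<Phi>(v)\<close> of \<open>N(d v) + R\<^sub>s\<close> at \<open>v = V\<^sub>\<mu>\<close>, and \<open>\<Phi>(v)\<close> is symmetric for every \<open>v\<close>. So fixed points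
  and iterates are those of the scalar map \<open>F(v) = V\<^bsub>\<Phi>(v)\<^esub>\<close> on \<open>[0, 4]\<close>. This map is nondecreasing
  and continuous away from \<open>0\<close>; it need not be concave, but \<open>F(v) / v\<close> is strictly decreasing as long as
  \<open>F\<close> is positive, which gives uniqueness and the convergence of monotone iterations. Fatou's lemma
  as \<open>v \<rightarrow> 0\<close> gives \<open>liminf F(v) / v \<ge> E[d]\<close> for trivial \<open>\<mu>\<^sub>s\<close>, hence the threshold.

  For the ratio, fix \<open>d\<close> and put \<open>s = d v = 4 t\<^sup>2\<close>. By the symmetry of \<open>\<mu>\<^sub>s\<close>, the value
  \<open>E[tanh\<^sup>2((R\<^sub>s + N(s)) / 2)]\<close> is a mixture over \<open>y = R\<^sub>s / 2\<close> of the functions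
  \<open>h(t, y) = cosh y - exp(- t\<^sup>2 / 2) E[sech X]\<close> with \<open>X = y + t Z\<close>, \<open>Z\<close> standard Gaussian. Stein's identity
  gives \<open>\<partial>h/\<partial>t = 2 t exp(- t\<^sup>2 / 2) E[sech\<^sup>3 X]\<close>, so \<open>h / t\<^sup>2\<close> decreases if and only if
  \<open>t\<^sup>2 E[sech\<^sup>3 X] < E[sinh X tanh X]\<close>; and indeed
  \<open>t\<^sup>2 E[sech\<^sup>3 X] < t\<^sup>2 E[sech\<^sup>2 X] = E[(X - y) tanh X] \<le> E[X tanh X] \<le> E[sinh X tanh X]\<close>,
  where the second step is Stein's identity again and the third uses \<open>y E[tanh X] \<ge> 0\<close>.
\<close>

section \<open>Gaussian expectations\<close>

definition std_gauss :: "real measure" where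
  "std_gauss = density lborel (\<lambda>x. ennreal (std_normal_density x))"

lemma sets_std_gauss [simp, measurable_cong]: "sets std_gauss = sets borel"
  by (simp add: std_gauss_def)

lemma space_std_gauss [simp]: "space std_gauss = UNIV"
  by (simp add: std_gauss_def)

definition sech :: "real \<Rightarrow> real" where
  "sech x = inverse (cosh x)"

interpretation gauss: prob_space std_gauss
  unfolding std_gauss_def by (rule prob_space_normal_density) simp

lemma prob_std_gauss_UNIV [simp]: "gauss.prob UNIV = 1"
  using gauss.prob_space by simp

lemma emeasure_std_gauss_UNIV [simp]: "emeasure std_gauss UNIV = 1"
  using gauss.emeasure_space_1 by simp

text \<open>The density is positive everywhere, so the Gaussian and Lebesgue measure have the same
  null sets.\<close>

lemma AE_gauss_iff_lborel:
  "Measurable.pred borel Q \<Longrightarrow> (AE z in std_gauss. Q z) \<longleftrightarrow> (AE z in lborel. Q z)"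
  unfolding std_gauss_def by (subst AE_density) (auto simp: normal_density_pos)

lemma AE_gauss_neq: "AE z in std_gauss. z \<noteq> c"
  by (subst AE_gauss_iff_lborel) (auto intro: AE_lborel_singleton)

lemma integral_gauss:
  fixes f :: "real \<Rightarrow> real"
  assumes [measurable]: "f \<in> borel_measurable borel"
  shows "(\<integral>z. f z \<partial>std_gauss) = (\<integral>z. std_normal_density z * f z \<partial>lborel)"
  unfolding std_gauss_def by (subst integral_density) auto

lemma integrable_gauss:
  fixes f :: "real \<Rightarrow> real"
  assumes [measurable]: "f \<in> borel_measurable borel"
  shows "integrable std_gauss f \<longleftrightarrow> integrable lborel (\<lambda>z. std_normal_density z * f z)"
  unfolding std_gauss_def by (subst integrable_density) auto

lemma integrable_gauss_power: "integrable std_gauss (\<lambda>z. z ^ k)"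
  by (subst integrable_gauss) (auto intro: integrable_std_normal_moment)

lemma integrable_gauss_bounded:
  fixes f :: "real \<Rightarrow> real"
  assumes "f \<in> borel_measurable borel" "\<And>x. \<bar>f x\<bar> \<le> B"
  shows "integrable std_gauss f"
  by (rule gauss.integrable_const_bound[of _ B]) (use assms in auto)

lemma integrable_gauss_mult_bounded:
  fixes f :: "real \<Rightarrow> real"
  assumes [measurable]: "f \<in> borel_measurable borel" and "\<And>x. \<bar>f x\<bar> \<le> B"
  shows "integrable std_gauss (\<lambda>z. z * f z)"
proof (rule Bochner_Integration.integrable_bound)
  show "integrable std_gauss (\<lambda>z. z ^ 1 * B)"
    using integrable_gauss_power[of 1] by (intro integrable_mult_left) 
  show "AE z in std_gauss. norm (z * f z) \<le> norm (z ^ 1 * B)"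
    using assms(2) by (auto simp: abs_mult intro!: mult_left_mono AE_I2 intro: order_trans[OF _ abs_ge_self])
qed simp

lemma DERIV_std_normal_density:
  "(std_normal_density has_real_derivative - x * std_normal_density x) (at x)"
  unfolding std_normal_density_def[abs_def]
  by (auto intro!: derivative_eq_intros simp: field_simps)

lemma std_normal_density_at_top: "(std_normal_density \<longlongrightarrow> 0) at_top"
proof -
  have "filterlim (\<lambda>x::real. x\<^sup>2 / 2) at_top at_top"
  proof (rule filterlim_at_top_mono[OF filterlim_ident])
    have "x \<le> x\<^sup>2 / 2" if "2 \<le> x" for x :: real
      using mult_right_mono[OF that, of x] that by (simp add: power2_eq_square)
    then show "\<forall>\<^sub>F x::real in at_top. x \<le> x\<^sup>2 / 2"
      by (auto simp: eventually_at_top_linorder)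
  qed
  then have "((\<lambda>x::real. exp (- (x\<^sup>2 / 2))) \<longlongrightarrow> 0) at_top"
    by (intro filterlim_compose[OF exp_at_bot] filterlim_compose[OF filterlim_uminus_at_bot_at_top])
  then have "((\<lambda>x::real. (1 / sqrt (2 * pi)) * exp (- (x\<^sup>2 / 2))) \<longlongrightarrow> (1 / sqrt (2 * pi)) * 0) at_top"
    by (rule tendsto_mult_left)
  then show ?thesis by (simp add: std_normal_density_def[abs_def])
qed

lemma std_normal_density_at_bot: "(std_normal_density \<longlongrightarrow> 0) at_bot"
  using std_normal_density_at_top
  unfolding filterlim_at_bot_mirror by (simp add: std_normal_density_def[abs_def])

section \<open>Stein's identity and differentiation under the integral\<close>

text \<open>Integration by parts: the derivative of \<open>f z * std_normal_density z\<close>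
  integrates to zero over the line, because \<open>f\<close> is bounded and the density vanishes at
  both ends. The bounds on \<open>f\<close> and \<open>f'\<close> make both sides
  integrable.\<close>

lemma gauss_stein:
  fixes f f' :: "real \<Rightarrow> real"
  assumes der: "\<And>x. (f has_real_derivative f' x) (at x)"
    and bf: "\<And>x. \<bar>f x\<bar> \<le> B" and bf': "\<And>x. \<bar>f' x\<bar> \<le> B'"
    and cf': "continuous_on UNIV f'"
  shows "(\<integral>z. z * f z \<partial>std_gauss) = (\<integral>z. f' z \<partial>std_gauss)"
proof -
  have cf: "continuous_on UNIV f"
    using der by (auto intro!: continuous_at_imp_continuous_on DERIV_isCont)
  have [measurable]: "f \<in> borel_measurable borel" "f' \<in> borel_measurable borel"
    using cf cf' by (auto intro: borel_measurable_continuous_onI)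
  let ?F = "\<lambda>z. f z * std_normal_density z"
  let ?F' = "\<lambda>z. std_normal_density z * f' z - std_normal_density z * (z * f z)"
  have i1: "integrable std_gauss (\<lambda>z. z * f z)"
    by (rule integrable_gauss_mult_bounded[OF _ bf]) simp
  have i2: "integrable std_gauss f'"
    by (rule integrable_gauss_bounded[OF _ bf']) simp
  have int: "integrable lborel ?F'"
    using i1 i2 by (subst (asm) (1 2) integrable_gauss) auto
  have lim: "(?F \<longlongrightarrow> 0) F" if "(std_normal_density \<longlongrightarrow> 0) F" for F
  proof (rule Lim_null_comparison)
    show "\<forall>\<^sub>F z in F. norm (?F z) \<le> B * std_normal_density z"
      using bf by (intro always_eventually allI) (simp add: abs_mult mult_right_mono)
    show "((\<lambda>z. B * std_normal_density z) \<longlongrightarrow> 0) F"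
      using tendsto_mult_left[OF that, of B] by simp
  qed
  have "(LBINT x=-\<infinity>..\<infinity>. ?F' x) = 0 - 0"
  proof (rule interval_integral_FTC_integrable[where F = ?F])
    fix x
    show "(?F has_vector_derivative ?F' x) (at x)"
      unfolding has_real_derivative_iff_has_vector_derivative[symmetric]
      by (rule derivative_eq_intros der DERIV_std_normal_density refl)+ (simp add: algebra_simps)
    have "isCont f' x" "isCont f x"
      using cf cf' by (auto simp: continuous_on_eq_continuous_at)
    then show "isCont ?F' x"
      using DERIV_isCont[OF DERIV_std_normal_density] by (auto intro!: continuous_intros)
  next
    show "set_integrable lborel (einterval (-\<infinity>) \<infinity>) ?F'"
      using int by (simp add: set_integrable_def)
    show "((?F \<circ> real_of_ereal) \<longlongrightarrow> 0) (at_right (-\<infinity>))"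
      using lim[OF std_normal_density_at_bot]
      unfolding ereal_tendsto_simps .
    show "((?F \<circ> real_of_ereal) \<longlongrightarrow> 0) (at_left \<infinity>)"
      using lim[OF std_normal_density_at_top]
      unfolding ereal_tendsto_simps .
  qed simp
  then have "(\<integral>x. ?F' x \<partial>lborel) = 0"
    by (simp add: interval_integral_to_infinity_eq interval_lebesgue_integral_def set_lebesgue_integral_def)
  then show ?thesis
    using i1 i2 by (subst (asm) (1 2) integrable_gauss) (auto simp: integral_gauss)
qed

text \<open>Dominated convergence along an arbitrary sequence tending to \<open>t0\<close>. Since
  \<open>b\<close> bounds the derivative uniformly in \<open>t\<close>, the mean value bound makes
  \<open>b z\<close> a majorant of every difference quotient.\<close>

lemma has_real_derivative_integral:
  fixes k k' :: "real \<Rightarrow> 'a \<Rightarrow> real"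
  assumes der: "\<And>t z. ((\<lambda>t. k t z) has_real_derivative k' t z) (at t)"
    and int: "\<And>t. integrable M (k t)" and bd: "\<And>t z. \<bar>k' t z\<bar> \<le> b z"
    and b: "integrable M b" and [measurable]: "k' t0 \<in> borel_measurable M"
  shows "((\<lambda>t. \<integral>z. k t z \<partial>M) has_real_derivative (\<integral>z. k' t0 z \<partial>M)) (at t0)"
  unfolding has_field_derivative_iff tendsto_at_iff_sequentially
proof (intro allI impI)
  fix X :: "nat \<Rightarrow> real"
  assume X: "\<forall>i. X i \<in> UNIV - {t0}" "X \<longlonglongrightarrow> t0"
  have [measurable]: "k t \<in> borel_measurable M" for t using int by auto
  have "(\<lambda>i. \<integral>z. (k (X i) z - k t0 z) / (X i - t0) \<partial>M) \<longlonglongrightarrow> (\<integral>z. k' t0 z \<partial>M)"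
  proof (rule integral_dominated_convergence[where w = b])
    show "AE z in M. (\<lambda>i. (k (X i) z - k t0 z) / (X i - t0)) \<longlonglongrightarrow> k' t0 z"
      using der[of _ t0] X unfolding has_field_derivative_iff tendsto_at_iff_sequentially comp_def
      by auto
    show "AE z in M. norm ((k (X i) z - k t0 z) / (X i - t0)) \<le> b z" for i
    proof (rule AE_I2)
      fix z
      have "\<bar>k (X i) z - k t0 z\<bar> \<le> b z * \<bar>X i - t0\<bar>"
        using field_differentiable_bound[of UNIV "\<lambda>t. k t z" "\<lambda>t. k' t z" "b z" "X i" t0] der bd
        by (auto intro: DERIV_subset)
      then show "norm ((k (X i) z - k t0 z) / (X i - t0)) \<le> b z"
        using X(1) by (simp add: field_simps)
    qed
  qed (use b in auto)
  then show "((\<lambda>t. ((\<integral>z. k t z \<partial>M) - (\<integral>z. k t0 z \<partial>M)) / (t - t0)) \<circ> X) \<longlonglongrightarrow> (\<integral>z. k' t0 z \<partial>M)"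
    using int by (simp add: comp_def)
qed

section \<open>The hyperbolic secant\<close>

lemma sech_pos [simp]: "0 < sech x" "0 \<le> sech x"
  by (auto simp: sech_def)

lemma sech_le_1 [simp]: "sech x \<le> 1"
  using cosh_real_ge_1[of x] by (simp add: sech_def inverse_le_1_iff)

lemma sech_0 [simp]: "sech 0 = 1"
  by (simp add: sech_def)

lemma sech_minus [simp]: "sech (- x) = sech x"
  by (simp add: sech_def)

lemma tanh_square: "(tanh x)\<^sup>2 = 1 - (sech x)\<^sup>2" for x :: real
  using cosh_real_nonzero[of x]
  by (simp add: sech_def tanh_def sinh_square_eq power_divide power_inverse diff_divide_distrib inverse_eq_divide)

lemma abs_tanh_le_1 [simp]: "\<bar>tanh x\<bar> \<le> 1" for x :: real
  using tanh_real_bounds[of x] by auto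

lemma DERIV_sech [THEN DERIV_chain2, derivative_intros]:
  "(sech has_real_derivative - (sech x * tanh x)) (at x)"
  unfolding sech_def[abs_def]
  by (auto intro!: derivative_eq_intros simp: tanh_def field_simps power2_eq_square)

lemma continuous_sech: "continuous_on UNIV sech"
  unfolding sech_def[abs_def] by (intro continuous_intros) auto

lemma sech_measurable [measurable]: "sech \<in> borel_measurable borel"
  using continuous_sech by (rule borel_measurable_continuous_onI)

lemma tanh_measurable [measurable]: "tanh \<in> borel_measurable (borel :: real measure)"
  by (rule borel_measurable_continuous_onI) (intro continuous_intros; simp)

section \<open>Translation, reflection and exponential moments of the Gaussian\<close>

text \<open>The Cameron-Martin formula: substitute \<open>z - c\<close> and complete the square in
  the density. The equivalence of integrability yields exponential moments from constant
  functions.\<close>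

lemma integral_gauss_shift:
  fixes f :: "real \<Rightarrow> real"
  assumes [measurable]: "f \<in> borel_measurable borel"
  shows "(\<integral>z. f (z + c) \<partial>std_gauss) = (\<integral>z. exp (c * z - c\<^sup>2 / 2) * f z \<partial>std_gauss)"
    and "integrable std_gauss (\<lambda>z. f (z + c)) \<longleftrightarrow> integrable std_gauss (\<lambda>z. exp (c * z - c\<^sup>2 / 2) * f z)"
proof -
  have *: "std_normal_density (- c + 1 * z) * f (- c + 1 * z + c)
      = std_normal_density z * (exp (c * z - c\<^sup>2 / 2) * f z)" for z
    by (simp add: std_normal_density_def exp_add[symmetric] power2_eq_square field_simps)
  show "(\<integral>z. f (z + c) \<partial>std_gauss) = (\<integral>z. exp (c * z - c\<^sup>2 / 2) * f z \<partial>std_gauss)"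
    using lborel_integral_real_affine[of 1 "\<lambda>z. std_normal_density z * f (z + c)" "- c"]
    by (simp only: *) (simp add: integral_gauss)
  show "integrable std_gauss (\<lambda>z. f (z + c)) \<longleftrightarrow> integrable std_gauss (\<lambda>z. exp (c * z - c\<^sup>2 / 2) * f z)"
    using lborel_integrable_real_affine_iff[of 1 "\<lambda>z. std_normal_density z * f (z + c)" "- c"]
    by (simp only: *) (simp add: integrable_gauss)
qed

lemma integral_gauss_uminus:
  fixes f :: "real \<Rightarrow> real"
  assumes [measurable]: "f \<in> borel_measurable borel"
  shows "(\<integral>z. f (- z) \<partial>std_gauss) = (\<integral>z. f z \<partial>std_gauss)"
  using lborel_integral_real_affine[of "-1" "\<lambda>z. std_normal_density z * f z" 0]
  by (simp add: integral_gauss std_normal_density_def)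

lemma gauss_exp:
  "integrable std_gauss (\<lambda>z. exp (c * z))" "(\<integral>z. exp (c * z) \<partial>std_gauss) = exp (c\<^sup>2 / 2)"
proof -
  have *: "exp (c * z - c\<^sup>2 / 2) * 1 = exp (- (c\<^sup>2 / 2)) * exp (c * z)" for z
    by (simp add: exp_add[symmetric])
  show "integrable std_gauss (\<lambda>z. exp (c * z))"
    using integral_gauss_shift(2)[of "\<lambda>_. 1" c] unfolding * by simp
  show "(\<integral>z. exp (c * z) \<partial>std_gauss) = exp (c\<^sup>2 / 2)"
    using integral_gauss_shift(1)[of "\<lambda>_. 1" c] unfolding *
    by (simp add: gauss.prob_space exp_minus field_simps)
qed

lemma gauss_cosh:
  "integrable std_gauss (\<lambda>z. cosh (y + t * z))"
  "(\<integral>z. cosh (y + t * z) \<partial>std_gauss) = exp (t\<^sup>2 / 2) * cosh y"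
proof -
  have *: "cosh (y + t * z) = exp y / 2 * exp (t * z) + exp (- y) / 2 * exp ((- t) * z)" for z
  proof -
    have "exp (- (y + t * z)) = exp (- y) * exp ((- t) * z)"
      by (simp add: exp_add[symmetric])
    then show ?thesis by (simp add: cosh_field_def exp_add add_divide_distrib)
  qed
  show "integrable std_gauss (\<lambda>z. cosh (y + t * z))"
    unfolding * by (intro Bochner_Integration.integrable_add integrable_mult_right gauss_exp)
  show "(\<integral>z. cosh (y + t * z) \<partial>std_gauss) = exp (t\<^sup>2 / 2) * cosh y"
    unfolding * using gauss_exp[of t] gauss_exp[of "- t"]
    by (subst Bochner_Integration.integral_add) (auto simp: cosh_field_def field_simps)
qed

section \<open>The inequality behind the decreasing ratio\<close>

text \<open>The values of \<open>tanh\<close> at the mirror points \<open>y + w\<close> and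
  \<open>y - w\<close> add up to a number with the sign of \<open>y\<close>. Averaged over the even
  Gaussian law this gives \<open>y * E[tanh X] >= 0\<close>, although the integrand
  \<open>y * tanh X\<close> alone has no constant sign.\<close>

lemma tanh_plus_tanh_nonneg: "0 \<le> y * (tanh (y + w) + tanh (y - w))" for y w :: real
proof (cases "0 \<le> y")
  case True
  have "tanh (w - y) \<le> tanh (y + w)"
    using True by (intro strict_mono_leD[OF tanh_real_strict_mono]) simp
  moreover have "tanh (w - y) = - tanh (y - w)"
    using tanh_minus[of "y - w"] by simp
  ultimately show ?thesis using True by simp
next
  case False
  have "tanh (y + w) \<le> tanh (w - y)"
    using False by (intro strict_mono_leD[OF tanh_real_strict_mono]) simp
  moreover have "tanh (w - y) = - tanh (y - w)"
    using tanh_minus[of "y - w"] by simp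
  ultimately show ?thesis using False by (intro mult_nonpos_nonpos) auto
qed

lemma le_sinh: "0 \<le> x \<Longrightarrow> x \<le> sinh x" for x :: real
  using real_le_x_sinh[of x] by (simp add: sinh_field_def exp_minus)

text \<open>The right side is \<open>sinh x * tanh x\<close>, both sides are even, and
  \<open>x <= sinh x\<close> for nonnegative \<open>x\<close>.\<close>

lemma mult_tanh_le: "x * tanh x \<le> cosh x - sech x" for x :: real
proof -
  have eq: "cosh x - sech x = sinh x * tanh x"
    using cosh_square_eq[of x] by (simp add: sech_def tanh_def field_simps power2_eq_square)
  have nn: "x * tanh x \<le> sinh x * tanh x" if "0 \<le> x" for x :: real
    using that le_sinh by (intro mult_right_mono) auto
  show ?thesis
    unfolding eq using nn[of x] nn[of "- x"] by (cases "0 \<le> x") auto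
qed

text \<open>With \<open>X = y + t * z\<close> the right side is
  \<open>E[cosh X - sech X] = E[sinh X * tanh X]\<close>. The strictness of the whole chain comes
  from its first link, which replaces \<open>sech ^ 3\<close> by \<open>sech ^ 2\<close>.\<close>

lemma gauss_sech_cube_less:
  assumes "t \<noteq> 0"
  shows "t\<^sup>2 * (\<integral>z. sech (y + t * z) ^ 3 \<partial>std_gauss)
    < exp (t\<^sup>2 / 2) * cosh y - (\<integral>z. sech (y + t * z) \<partial>std_gauss)"
proof -
  have [simp]: "sech x ^ k \<le> 1" for x k by (rule power_le_one) auto
  have [simp]: "\<bar>sech x ^ k\<bar> \<le> 1" "\<bar>sech x\<bar> \<le> 1" for x k by auto
  have i: "integrable std_gauss (\<lambda>z. sech (y + t * z) ^ k)" for k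
    by (rule integrable_gauss_bounded[where B = 1]) auto
  have i1: "integrable std_gauss (\<lambda>z. sech (y + t * z))" using i[of 1] by simp
  have "(\<integral>z. sech (y + t * z) ^ 3 \<partial>std_gauss) < (\<integral>z. sech (y + t * z) ^ 2 \<partial>std_gauss)"
  proof (rule gauss.integral_less_AE_space)
    \<comment> \<open>\<open>X\<close> vanishes only at the point \<open>z = - y / t\<close>, which
      is a null set; everywhere else \<open>sech X < 1\<close>.\<close>
    show "AE z in std_gauss. sech (y + t * z) ^ 3 < sech (y + t * z) ^ 2"
      using AE_gauss_neq[of "- y / t"]
    proof eventually_elim
      case (elim z)
      then have "y + t * z \<noteq> 0" using assms by (auto simp: field_simps)
      then have "cosh (y + t * z) \<noteq> 1" by simp
      then have "1 < cosh (y + t * z)"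
        using cosh_real_ge_1[of "y + t * z"] by linarith
      then have "sech (y + t * z) < 1"
        by (simp add: sech_def inverse_less_1_iff)
      then show ?case
        using mult_strict_left_mono[of "sech (y + t * z)" 1 "sech (y + t * z) ^ 2"]
        by (simp add: power2_eq_square power3_eq_cube)
    qed
  qed (auto simp: i gauss.emeasure_space_1)
  then have "t\<^sup>2 * (\<integral>z. sech (y + t * z) ^ 3 \<partial>std_gauss) < t\<^sup>2 * (\<integral>z. sech (y + t * z) ^ 2 \<partial>std_gauss)"
    using assms by simp
  also have "\<dots> = t * (\<integral>z. t * sech (y + t * z) ^ 2 \<partial>std_gauss)"
    by (simp add: power2_eq_square)
  \<comment> \<open>Stein's identity for \<open>tanh (y + t * z)\<close>, read from right to
    left.\<close>
  also have "(\<integral>z. t * sech (y + t * z) ^ 2 \<partial>std_gauss) = (\<integral>z. z * tanh (y + t * z) \<partial>std_gauss)"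
  proof (rule gauss_stein[symmetric])
    show "((\<lambda>z. tanh (y + t * z)) has_real_derivative t * sech (y + t * x) ^ 2) (at x)" for x
      by (auto intro!: derivative_eq_intros simp: tanh_square)
    show "\<bar>t * sech (y + t * x) ^ 2\<bar> \<le> \<bar>t\<bar>" for x
      by (simp add: abs_mult mult_left_le)
    show "continuous_on UNIV (\<lambda>z. t * sech (y + t * z) ^ 2)"
      by (intro continuous_intros continuous_on_compose2[OF continuous_sech]) auto
  qed (rule abs_tanh_le_1)
  \<comment> \<open>Adding \<open>y * E[tanh X]\<close> completes the factor \<open>t * z\<close> to
    \<open>X\<close>; this extra term is nonnegative and is dropped afterwards.\<close>
  also have "t * (\<integral>z. z * tanh (y + t * z) \<partial>std_gauss) + y * (\<integral>z. tanh (y + t * z) \<partial>std_gauss)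
      = (\<integral>z. (y + t * z) * tanh (y + t * z) \<partial>std_gauss)"
  proof -
    have "integrable std_gauss (\<lambda>z. z * tanh (y + t * z))" "integrable std_gauss (\<lambda>z. tanh (y + t * z))"
      by (intro integrable_gauss_mult_bounded[where B = 1] integrable_gauss_bounded[where B = 1]; simp)+
    then show ?thesis by (simp add: ring_distribs mult.assoc)
  qed
  then have "t * (\<integral>z. z * tanh (y + t * z) \<partial>std_gauss)
      = (\<integral>z. (y + t * z) * tanh (y + t * z) \<partial>std_gauss) - y * (\<integral>z. tanh (y + t * z) \<partial>std_gauss)"
    by simp
  also have "\<dots> \<le> (\<integral>z. (y + t * z) * tanh (y + t * z) \<partial>std_gauss)"
  proof -
    have int: "integrable std_gauss (\<lambda>z. tanh (y + t * z))" "integrable std_gauss (\<lambda>z. tanh (y - t * z))"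
      by (intro integrable_gauss_bounded[where B = 1]; simp)+
    \<comment> \<open>Averaging over \<open>z\<close> and \<open>- z\<close> makes the integrand
      nonnegative pointwise and only doubles the integral.\<close>
    have "0 \<le> (\<integral>z. y * (tanh (y + t * z) + tanh (y - t * z)) \<partial>std_gauss)"
      by (intro integral_nonneg_AE AE_I2 tanh_plus_tanh_nonneg)
    also have "\<dots> = y * ((\<integral>z. tanh (y + t * z) \<partial>std_gauss) + (\<integral>z. tanh (y + t * (- z)) \<partial>std_gauss))"
      using int by simp
    also have "(\<integral>z. tanh (y + t * (- z)) \<partial>std_gauss) = (\<integral>z. tanh (y + t * z) \<partial>std_gauss)"
      by (rule integral_gauss_uminus) simp
    finally show ?thesis by simp
  qed
  also have "\<dots> \<le> (\<integral>z. cosh (y + t * z) - sech (y + t * z) \<partial>std_gauss)"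
  proof (rule integral_mono)
    have "integrable std_gauss (\<lambda>z. y * tanh (y + t * z) + t * (z * tanh (y + t * z)))"
      by (intro Bochner_Integration.integrable_add integrable_mult_right 
        integrable_gauss_mult_bounded[where B = 1] integrable_gauss_bounded[where B = 1]; simp)
    then show "integrable std_gauss (\<lambda>z. (y + t * z) * tanh (y + t * z))"
      by (simp add: ring_distribs mult.assoc)
  qed (use i1 gauss_cosh mult_tanh_le in auto)
  also have "\<dots> = exp (t\<^sup>2 / 2) * cosh y - (\<integral>z. sech (y + t * z) \<partial>std_gauss)"
    using i1 gauss_cosh by simp
  finally show ?thesis .
qed

text \<open>
  For \<open>R = 2 * y + N(4 * t\<^sup>2)\<close> this is \<open>E[tanh\<^sup>2(R / 2)]\<close> averaged over the two signs
  of \<open>y\<close> with weights \<open>exp y / 2\<close> and \<open>exp (- y) / 2\<close>; see \<open>tilted_info_eq\<close>.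
\<close>

definition tilted_info :: "real \<Rightarrow> real \<Rightarrow> real" where
  "tilted_info t y = cosh y - exp (- t\<^sup>2 / 2) * (\<integral>z. sech (y + t * z) \<partial>std_gauss)"

section \<open>Derivative and monotonicity of \<open>tilted_info\<close>\<close>

text \<open>Differentiation brings down a factor \<open>z\<close>. Stein's identity trades it for
  \<open>t\<close> times the derivative of \<open>sech * tanh\<close>, which is
  \<open>2 * sech ^ 3 - sech\<close>.\<close>

lemma DERIV_gauss_sech:
  "((\<lambda>t. \<integral>z. sech (y + t * z) \<partial>std_gauss) has_real_derivative
     t * (\<integral>z. sech (y + t * z) \<partial>std_gauss) - 2 * t * (\<integral>z. sech (y + t * z) ^ 3 \<partial>std_gauss)) (at t)"
proof -
  let ?f = "\<lambda>x. sech x * tanh x"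
  have bf: "\<bar>?f x\<bar> \<le> 1" for x
    by (simp add: abs_mult mult_le_one)
  have [measurable]: "?f \<in> borel_measurable borel" by simp
  have "((\<lambda>t. \<integral>z. sech (y + t * z) \<partial>std_gauss) has_real_derivative
     (\<integral>z. - (z * ?f (y + t * z)) \<partial>std_gauss)) (at t)"
  proof (rule has_real_derivative_integral)
    show "((\<lambda>t. sech (y + t * z)) has_real_derivative - (z * ?f (y + t * z))) (at t)" for t z
      by (auto intro!: derivative_eq_intros)
    show "integrable std_gauss (\<lambda>z. sech (y + t * z))" for t
      by (rule integrable_gauss_bounded[where B = 1]) auto
    show "\<bar>- (z * ?f (y + t * z))\<bar> \<le> \<bar>z\<bar>" for t z
      using bf[of "y + t * z"] mult_left_mono[of "\<bar>?f (y + t * z)\<bar>" 1 "\<bar>z\<bar>"] by (simp add: abs_mult)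
    show "integrable std_gauss (\<lambda>z. \<bar>z\<bar>)"
      using integrable_gauss_power[of 1] by simp
  qed simp
  moreover have "(\<integral>z. z * ?f (y + t * z) \<partial>std_gauss)
      = (\<integral>z. t * (2 * sech (y + t * z) ^ 3 - sech (y + t * z)) \<partial>std_gauss)"
  proof (rule gauss_stein)
    show "((\<lambda>z. ?f (y + t * z)) has_real_derivative t * (2 * sech (y + t * x) ^ 3 - sech (y + t * x))) (at x)" for x
    proof -
      have eq: "sech u * (1 - (tanh u)\<^sup>2) + - (sech u * tanh u) * tanh u = 2 * sech u ^ 3 - sech u" for u
      proof -
        have "sech u * (1 - (tanh u)\<^sup>2) + - (sech u * tanh u) * tanh u = sech u * (1 - 2 * (tanh u)\<^sup>2)"
          by (simp add: algebra_simps power2_eq_square)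
        also have "\<dots> = 2 * sech u ^ 3 - sech u"
          by (simp only: tanh_square) (simp add: algebra_simps power2_eq_square power3_eq_cube)
        finally show ?thesis .
      qed
      have "(?f has_real_derivative 2 * sech u ^ 3 - sech u) (at u)" for u
        by (rule DERIV_cong[OF DERIV_mult'[OF DERIV_sech[OF DERIV_ident] has_field_derivative_tanh[OF _ DERIV_ident]]])
          (use eq[of u] in simp_all)
      moreover have "((\<lambda>z. y + t * z) has_real_derivative t) (at x)"
        by (auto intro!: derivative_eq_intros)
      ultimately show ?thesis
        by (subst mult.commute) (rule DERIV_chain2)
    qed
    show "\<bar>t * (2 * sech (y + t * x) ^ 3 - sech (y + t * x))\<bar> \<le> \<bar>t\<bar> * 2" for x
    proof -
      have "sech (y + t * x) ^ 3 \<le> 1" "0 \<le> sech (y + t * x) ^ 3"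
        by (auto intro: power_le_one)
      then have "\<bar>2 * sech (y + t * x) ^ 3 - sech (y + t * x)\<bar> \<le> 2"
        using sech_pos[of "y + t * x"] sech_le_1[of "y + t * x"] by linarith
      then show ?thesis unfolding abs_mult by (intro mult_left_mono) auto
    qed
    show "continuous_on UNIV (\<lambda>z. t * (2 * sech (y + t * z) ^ 3 - sech (y + t * z)))"
      by (intro continuous_intros continuous_on_compose2[OF continuous_sech]) auto
    show "\<bar>?f (y + t * x)\<bar> \<le> 1" for x by (rule bf)
  qed
  moreover have "integrable std_gauss (\<lambda>z. sech (y + t * z) ^ 3)" "integrable std_gauss (\<lambda>z. sech (y + t * z))"
    by (rule integrable_gauss_bounded[where B = 1]; auto intro: power_le_one)+
  ultimately show ?thesis by (simp add: algebra_simps)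
qed

text \<open>The factor \<open>exp (- t\<^sup>2 / 2)\<close> acts as an integrating factor: its
  derivative cancels the first power of \<open>sech\<close> in \<open>DERIV_gauss_sech\<close>, and
  what remains has the sign of \<open>t\<close>.\<close>

lemma DERIV_tilted_info:
  "((\<lambda>t. tilted_info t y) has_real_derivative
     2 * t * exp (- t\<^sup>2 / 2) * (\<integral>z. sech (y + t * z) ^ 3 \<partial>std_gauss)) (at t)"
proof -
  have e: "((\<lambda>t::real. exp (- t\<^sup>2 / 2)) has_real_derivative - t * exp (- t\<^sup>2 / 2)) (at t)"
    by (auto intro!: derivative_eq_intros)
  show ?thesis
    unfolding tilted_info_def
    by (rule DERIV_cong[OF DERIV_diff[OF DERIV_const DERIV_mult[OF e DERIV_gauss_sech]]])
      (simp add: algebra_simps)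
qed

lemma gauss_sech_cube: "0 \<le> (\<integral>z. sech (y + t * z) ^ 3 \<partial>std_gauss)" "(\<integral>z. sech (y + t * z) ^ 3 \<partial>std_gauss) \<le> 1"
  by (auto intro!: integral_nonneg_AE gauss.integral_le_const integrable_gauss_bounded[where B = 1] power_le_one)

lemma tilted_info_mono: "0 \<le> t \<Longrightarrow> t \<le> t' \<Longrightarrow> tilted_info t y \<le> tilted_info t' y"
  by (rule DERIV_nonneg_imp_nondecreasing)
    (auto intro!: exI DERIV_tilted_info mult_nonneg_nonneg gauss_sech_cube)

text \<open>The derivative of the quotient has the sign of
  \<open>s\<^sup>2 * B - (exp (s\<^sup>2 / 2) * cosh y - C)\<close>, which is negative by
  \<open>gauss_sech_cube_less\<close>.\<close>

lemma tilted_info_ratio: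
  assumes "0 < t" "t < t'"
  shows "tilted_info t' y / t'\<^sup>2 < tilted_info t y / t\<^sup>2"
  using assms(2)
proof (rule DERIV_neg_imp_decreasing)
  fix s assume "t \<le> s" "s \<le> t'"
  with assms have s: "0 < s" by simp
  define B where "B = (\<integral>z. sech (y + s * z) ^ 3 \<partial>std_gauss)"
  define C where "C = (\<integral>z. sech (y + s * z) \<partial>std_gauss)"
  have "((\<lambda>t. tilted_info t y / t\<^sup>2) has_real_derivative
      ((2 * s * exp (- s\<^sup>2 / 2) * B) * s\<^sup>2 - tilted_info s y * (2 * s)) / (s\<^sup>2 * s\<^sup>2)) (at s)"
    unfolding B_def
    by (rule derivative_eq_intros DERIV_tilted_info refl)+ (use s in auto)
  moreover have "((2 * s * exp (- s\<^sup>2 / 2) * B) * s\<^sup>2 - tilted_info s y * (2 * s))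
      = 2 * s * exp (- s\<^sup>2 / 2) * (s\<^sup>2 * B - (exp (s\<^sup>2 / 2) * cosh y - C))"
    unfolding tilted_info_def C_def by (simp add: algebra_simps exp_add[symmetric])
  moreover have "s\<^sup>2 * B - (exp (s\<^sup>2 / 2) * cosh y - C) < 0"
    using gauss_sech_cube_less[of s y] s by (simp add: B_def C_def)
  ultimately show "\<exists>d. ((\<lambda>t. tilted_info t y / t\<^sup>2) has_real_derivative d) (at s) \<and> d < 0"
    using s by (intro exI conjI) (auto intro!: divide_neg_pos mult_pos_neg)
qed

text \<open>Both sides vanish at \<open>0\<close>, and their difference has derivative
  \<open>2 * s * (exp (- s\<^sup>2 / 2) * B - 1) < 0\<close>. This bound is what forces
  \<open>E[d] > 1\<close> at a positive fixed point when \<open>\<mu>s\<close> is trivial.\<close>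

lemma tilted_info_less_square:
  assumes "0 < t"
  shows "tilted_info t 0 < t\<^sup>2"
proof -
  have "tilted_info t 0 - t\<^sup>2 < tilted_info 0 0 - 0\<^sup>2"
  proof (rule DERIV_neg_imp_decreasing_open[OF assms])
    fix s :: real assume s: "0 < s" "s < t"
    define B where "B = (\<integral>z. sech (0 + s * z) ^ 3 \<partial>std_gauss)"
    have "((\<lambda>t. tilted_info t 0 - t\<^sup>2) has_real_derivative 2 * s * exp (- s\<^sup>2 / 2) * B - 2 * s) (at s)"
      unfolding B_def by (rule derivative_eq_intros DERIV_tilted_info refl)+ auto
    moreover have "exp (- s\<^sup>2 / 2) * B < 1"
    proof -
      have "exp (- s\<^sup>2 / 2) * B \<le> exp (- s\<^sup>2 / 2) * 1"
        unfolding B_def by (intro mult_left_mono gauss_sech_cube) auto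
      also have "\<dots> < 1" using s by simp
      finally show ?thesis .
    qed
    then have "2 * s * exp (- s\<^sup>2 / 2) * B - 2 * s < 0"
      using s mult_strict_left_mono[of "exp (- s\<^sup>2 / 2) * B" 1 "2 * s"] by simp
    ultimately show "\<exists>d. ((\<lambda>t. tilted_info t 0 - t\<^sup>2) has_real_derivative d) (at s) \<and> d < 0"
      by blast
  next
    show "continuous_on {0..t} (\<lambda>t. tilted_info t 0 - t\<^sup>2)"
      by (intro continuous_intros continuous_at_imp_continuous_on ballI DERIV_isCont[OF DERIV_tilted_info])
  qed
  then show ?thesis by (simp add: tilted_info_def gauss.prob_space)
qed

section \<open>Girsanov shift between squares of \<open>tanh\<close> and
  \<open>tilted_info\<close>\<close>

text \<open>\<open>N(4 * t\<^sup>2)\<close> has mean \<open>2 * t\<^sup>2\<close> and standard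
  deviation \<open>2 * t\<close>, so the argument of \<open>tanh\<close> is half of
  \<open>2 * y + N(4 * t\<^sup>2)\<close>.\<close>

definition shifted_tanh_sq :: "real \<Rightarrow> real \<Rightarrow> real" where
  "shifted_tanh_sq t y = (\<integral>z. (tanh (y + t\<^sup>2 + t * z))\<^sup>2 \<partial>std_gauss)"

text \<open>Girsanov's shift turns the drift into the weight \<open>exp (y + t * z)\<close>, and the two signs add up to \<open>cosh\<close>.\<close>

lemma tilted_info_eq:
  "exp y * shifted_tanh_sq t y + exp (- y) * shifted_tanh_sq t (- y) = 2 * tilted_info t y"
proof -
  have int: "integrable std_gauss (\<lambda>z. (sech (a z))\<^sup>2)" if [measurable]: "a \<in> borel_measurable borel" for a
    by (rule integrable_gauss_bounded[where B = 1]) (auto intro: power_le_one)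
  \<comment> \<open>Translating the Gaussian by \<open>t\<close> absorbs exactly the drift, since
    \<open>u + t * (z + t) = u + t\<^sup>2 + t * z\<close>.\<close>
  have w: "exp u * (\<integral>z. (sech (u + t\<^sup>2 + t * z))\<^sup>2 \<partial>std_gauss)
      = exp (- t\<^sup>2 / 2) * (\<integral>z. exp (u + t * z) * (sech (u + t * z))\<^sup>2 \<partial>std_gauss)"
    and wi: "integrable std_gauss (\<lambda>z. exp (u + t * z) * (sech (u + t * z))\<^sup>2)" for u
  proof -
    have eq: "(\<lambda>z. exp (u + t * z) * (sech (u + t * z))\<^sup>2)
       = (\<lambda>z. (exp u * exp (t\<^sup>2 / 2)) * (exp (t * z - t\<^sup>2 / 2) * (sech (u + t * z))\<^sup>2))"
      by (simp add: exp_add exp_diff fun_eq_iff)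
    have sh: "u + t * (z + t) = u + t\<^sup>2 + t * z" for z
      by (simp add: power2_eq_square algebra_simps)
    show "integrable std_gauss (\<lambda>z. exp (u + t * z) * (sech (u + t * z))\<^sup>2)"
      unfolding eq using integral_gauss_shift(2)[of "\<lambda>z. (sech (u + t * z))\<^sup>2" t] int[of "\<lambda>z. u + t\<^sup>2 + t * z"]
      unfolding sh by (intro integrable_mult_right) simp
    show "exp u * (\<integral>z. (sech (u + t\<^sup>2 + t * z))\<^sup>2 \<partial>std_gauss)
      = exp (- t\<^sup>2 / 2) * (\<integral>z. exp (u + t * z) * (sech (u + t * z))\<^sup>2 \<partial>std_gauss)"
      unfolding eq using integral_gauss_shift(1)[of "\<lambda>z. (sech (u + t * z))\<^sup>2" t]
      unfolding sh by (simp add: exp_minus)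
  qed
  have s: "shifted_tanh_sq t u = 1 - (\<integral>z. (sech (u + t\<^sup>2 + t * z))\<^sup>2 \<partial>std_gauss)" for u
    unfolding shifted_tanh_sq_def tanh_square
    using int[of "\<lambda>z. u + t\<^sup>2 + t * z"] by (simp add: gauss.prob_space)
  \<comment> \<open>Reflecting \<open>z\<close> evaluates the contribution of \<open>- y\<close> at
    the same point \<open>y + t * z\<close>, with the opposite exponential weight.\<close>
  have fl: "(\<integral>z. exp (- y + t * z) * (sech (- y + t * z))\<^sup>2 \<partial>std_gauss)
      = (\<integral>z. exp (- (y + t * z)) * (sech (y + t * z))\<^sup>2 \<partial>std_gauss)"
    and fli: "integrable std_gauss (\<lambda>z. exp (- (y + t * z)) * (sech (y + t * z))\<^sup>2)"
  proof -
    have m: "- y + t * (- z) = - (y + t * z)" for z by simp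
    show "(\<integral>z. exp (- y + t * z) * (sech (- y + t * z))\<^sup>2 \<partial>std_gauss)
      = (\<integral>z. exp (- (y + t * z)) * (sech (y + t * z))\<^sup>2 \<partial>std_gauss)"
      using integral_gauss_uminus[of "\<lambda>z. exp (- y + t * z) * (sech (- y + t * z))\<^sup>2"]
      unfolding m sech_minus by simp
    show "integrable std_gauss (\<lambda>z. exp (- (y + t * z)) * (sech (y + t * z))\<^sup>2)"
    proof (rule Bochner_Integration.integrable_bound)
      show "integrable std_gauss (\<lambda>z. 2 * cosh (y + t * z))" using gauss_cosh by simp
      show "AE z in std_gauss. norm (exp (- (y + t * z)) * (sech (y + t * z))\<^sup>2) \<le> norm (2 * cosh (y + t * z))"
      proof (rule AE_I2)
        fix z
        have "exp (- (y + t * z)) * (sech (y + t * z))\<^sup>2 \<le> exp (- (y + t * z)) * 1"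
          by (intro mult_left_mono power_le_one) auto
        also have "\<dots> \<le> 2 * cosh (y + t * z)" unfolding cosh_field_def by simp
        finally show "norm (exp (- (y + t * z)) * (sech (y + t * z))\<^sup>2) \<le> norm (2 * cosh (y + t * z))"
          by simp
      qed
    qed simp
  qed
  \<comment> \<open>The two opposite weights add up to \<open>2 * cosh u\<close>, which lowers the
    power of \<open>sech\<close> from two to one.\<close>
  have "exp u * (sech u)\<^sup>2 + exp (- u) * (sech u)\<^sup>2 = 2 * sech u" for u
  proof -
    have "exp u + exp (- u) = 2 * cosh u" by (simp add: cosh_field_def)
    moreover have "cosh u * (sech u)\<^sup>2 = sech u" by (simp add: sech_def power2_eq_square)
    ultimately show ?thesis by (simp add: distrib_right[symmetric])
  qed
  then have "(\<integral>z. exp (y + t * z) * (sech (y + t * z))\<^sup>2 \<partial>std_gauss) + (\<integral>z. exp (- (y + t * z)) * (sech (y + t * z))\<^sup>2 \<partial>std_gauss)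
      = 2 * (\<integral>z. sech (y + t * z) \<partial>std_gauss)"
    by (subst Bochner_Integration.integral_add[OF wi fli, symmetric]) (simp del: minus_add_distrib)
  moreover have "exp y * shifted_tanh_sq t y + exp (- y) * shifted_tanh_sq t (- y)
     = 2 * cosh y - exp (- t\<^sup>2 / 2) * ((\<integral>z. exp (y + t * z) * (sech (y + t * z))\<^sup>2 \<partial>std_gauss)
       + (\<integral>z. exp (- y + t * z) * (sech (- y + t * z))\<^sup>2 \<partial>std_gauss))"
    unfolding s right_diff_distrib w by (simp add: cosh_field_def algebra_simps)
  ultimately show ?thesis
    unfolding fl tilted_info_def by simp
qed

section \<open>Symmetric distributions\<close>

definition info :: "ereal \<Rightarrow> real" where
  "info r = 4 * (tanh_ereal (r / 2))\<^sup>2"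

lemma tanh_ereal_measurable [measurable]: "tanh_ereal \<in> borel_measurable borel"
  unfolding tanh_ereal_def[abs_def] by measurable

lemma info_measurable [measurable]: "info \<in> borel_measurable borel"
  unfolding info_def[abs_def] by measurable

lemma info_simps [simp]:
  "info \<infinity> = 4" "info (-\<infinity>) = 4" "info (ereal x) = 4 * (tanh (x / 2))\<^sup>2" "info 0 = 0"
proof -
  show x: "info (ereal x) = 4 * (tanh (x / 2))\<^sup>2" for x
    by (simp add: info_def tanh_ereal_def)
  show "info 0 = 0" using x[of 0] by (simp add: zero_ereal_def[symmetric])
qed (simp_all add: info_def tanh_ereal_def)

lemma info_uminus [simp]: "info (- r) = info r"
  by (cases r) auto

lemma info_nonneg [simp]: "0 \<le> info r"
  by (simp add: info_def)

lemma info_le [simp]: "info r \<le> 4"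
  using abs_tanh_le_1 by (cases r) (auto simp: abs_square_le_1)

lemma info_eq_0_iff: "info r = 0 \<longleftrightarrow> r = 0"
  by (cases r) auto

lemma exp_neg_simps [simp]:
  "exp_neg \<infinity> = 0" "exp_neg (-\<infinity>) = \<infinity>" "exp_neg (ereal x) = ennreal (exp (- x))"
  by (auto simp: exp_neg_def)

section \<open>Gaussian laws as images of one standard Gaussian\<close>

text \<open>All laws \<open>gaussian_llr s\<close> live on the single space
  \<open>std_gauss\<close>, so continuity in \<open>s\<close> becomes pointwise convergence of
  integrands.\<close>

definition gauss_map :: "ennreal \<Rightarrow> real \<Rightarrow> ereal" where
  "gauss_map s z = (if s = \<infinity> then \<infinity> else ereal (enn2real s / 2 + sqrt (enn2real s) * z))"

lemma gauss_map_measurable [measurable]: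
  assumes [measurable]: "f \<in> borel_measurable M" "g \<in> borel_measurable M"
  shows "(\<lambda>x. gauss_map (f x) (g x)) \<in> borel_measurable M"
  unfolding gauss_map_def by measurable

lemma gauss_map_neq_MInfty [simp]: "gauss_map s z \<noteq> -\<infinity>"
  by (simp add: gauss_map_def)

lemma gauss_map_0 [simp]: "gauss_map 0 z = 0"
  by (simp add: gauss_map_def zero_ereal_def[symmetric])

lemma gauss_map_top [simp]: "gauss_map \<infinity> z = \<infinity>" "gauss_map top z = \<infinity>"
  by (simp_all add: gauss_map_def)

lemma nn_integral_std_gauss:
  assumes [measurable]: "f \<in> borel_measurable borel"
  shows "(\<integral>\<^sup>+z. f z \<partial>std_gauss) = (\<integral>\<^sup>+z. ennreal (std_normal_density z) * f z \<partial>lborel)"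
  unfolding std_gauss_def by (subst nn_integral_density) auto

lemma nn_integral_gaussian_llr:
  assumes [measurable]: "f \<in> borel_measurable borel"
  shows "(\<integral>\<^sup>+u. f u \<partial>gaussian_llr s) = (\<integral>\<^sup>+z. f (gauss_map s z) \<partial>std_gauss)"
proof -
  consider "s = 0" | "s = \<infinity>" | "s \<noteq> 0" "s \<noteq> \<infinity>" by blast
  then show ?thesis
  proof cases
    case 3
    define r where "r = enn2real s"
    have r: "0 < r" using 3 by (auto simp: r_def enn2real_positive_iff less_top zero_less_iff_neq_zero)
    have dens: "sqrt r * normal_density (r / 2) (sqrt r) (r / 2 + sqrt r * z) = std_normal_density z" for z
      using r by (simp add: normal_density_def power_mult_distrib real_sqrt_mult)
    have "(\<integral>\<^sup>+u. f u \<partial>gaussian_llr s) = (\<integral>\<^sup>+x. ennreal (normal_density (r / 2) (sqrt r) x) * f (ereal x) \<partial>lborel)"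
      using 3 by (simp add: gaussian_llr_def r_def nn_integral_distr nn_integral_density)
    also have "\<dots> = \<bar>sqrt r\<bar> * (\<integral>\<^sup>+z. ennreal (normal_density (r / 2) (sqrt r) (r / 2 + sqrt r * z)) * f (ereal (r / 2 + sqrt r * z)) \<partial>lborel)"
      by (rule nn_integral_real_affine) (use r in auto)
    also have "\<dots> = (\<integral>\<^sup>+z. ennreal (std_normal_density z) * f (ereal (r / 2 + sqrt r * z)) \<partial>lborel)"
      using r by (subst nn_integral_cmult[symmetric])
        (auto simp: dens[symmetric] ennreal_mult mult.assoc intro!: nn_integral_cong)
    also have "\<dots> = (\<integral>\<^sup>+z. f (gauss_map s z) \<partial>std_gauss)"
      using 3 by (simp add: nn_integral_std_gauss gauss_map_def r_def)
    finally show ?thesis .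
  qed (simp_all add: gaussian_llr_def nn_integral_return)
qed

text \<open>This is the symmetry of \<open>N(m\<^sup>2)\<close>: the substitution of
  \<open>- m - z\<close> for \<open>z\<close> negates \<open>m\<^sup>2 / 2 + m * z\<close>, and the
  density picks up exactly the weight \<open>exp (- (m\<^sup>2 / 2 + m * z))\<close>.\<close>

lemma nn_integral_gauss_symmetric:
  assumes [measurable]: "f \<in> borel_measurable borel"
  shows "(\<integral>\<^sup>+z. f (m\<^sup>2 / 2 + m * z) \<partial>std_gauss)
    = (\<integral>\<^sup>+z. ennreal (exp (- (m\<^sup>2 / 2 + m * z))) * f (- (m\<^sup>2 / 2 + m * z)) \<partial>std_gauss)"
proof -
  have 1: "m\<^sup>2 / 2 + m * (- m + (-1) * z) = - (m\<^sup>2 / 2 + m * z)" for z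
    by (simp add: power2_eq_square algebra_simps)
  have 2: "std_normal_density (- m + (-1) * z) = std_normal_density z * exp (- (m\<^sup>2 / 2 + m * z))" for z
    by (simp add: std_normal_density_def exp_add[symmetric] power2_eq_square field_simps)
  have "(\<integral>\<^sup>+z. ennreal (std_normal_density z) * f (m\<^sup>2 / 2 + m * z) \<partial>lborel)
      = ennreal \<bar>-1\<bar> * (\<integral>\<^sup>+z. ennreal (std_normal_density (- m + (-1) * z)) * f (m\<^sup>2 / 2 + m * (- m + (-1) * z)) \<partial>lborel)"
    by (rule nn_integral_real_affine) auto
  then show ?thesis
    unfolding 1 2 by (simp add: nn_integral_std_gauss ennreal_mult mult.assoc)
qed

section \<open>Integration against symmetric distributions\<close>

abbreviation finite_ereals :: "ereal set" where
  "finite_ereals \<equiv> {-\<infinity><..<\<infinity>}"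

lemma llr_line_distD:
  assumes "llr_line_dist \<mu>"
  shows "prob_space \<mu>" "sets \<mu> = sets borel" "space \<mu> = UNIV" "AE r in \<mu>. r \<noteq> -\<infinity>"
proof -
  show *: "prob_space \<mu>" "sets \<mu> = sets borel" using assms by (auto simp: llr_line_dist_def)
  show "space \<mu> = UNIV" using sets_eq_imp_space_eq[OF *(2)] by simp
  show "AE r in \<mu>. r \<noteq> -\<infinity>"
    using assms by (intro AE_I[of _ _ "{-\<infinity>}"]) (auto simp: llr_line_dist_def)
qed

text \<open>Symmetry says that \<open>\<mu>\<close> restricted to finite points is the reflection of
  its \<open>exp_neg\<close>-weighted version. Equality of these two measures passes to integrals;
  \<open>f\<close> vanishes at the infinities because the definition compares only sets of finite
  points.\<close>

lemma symmetric_dist_nn_integral: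
  assumes "symmetric_dist \<mu>" and [measurable]: "f \<in> borel_measurable borel"
    and "f \<infinity> = 0" "f (-\<infinity>) = 0"
  shows "(\<integral>\<^sup>+r. f r \<partial>\<mu>) = (\<integral>\<^sup>+r. exp_neg r * f (- r) \<partial>\<mu>)"
proof -
  let ?F = finite_ereals
  have s [measurable_cong]: "sets \<mu> = sets borel"
    using assms(1) by (simp add: symmetric_dist_def llr_line_dist_def)
  have sp: "space \<mu> = UNIV"
    using assms(1) by (simp add: symmetric_dist_def llr_line_distD)
  let ?M = "density \<mu> (indicator ?F)"
  let ?N = "distr (density \<mu> (\<lambda>r. exp_neg r * indicator ?F r)) borel uminus"
  have "?M = ?N"
  proof (rule measure_eqI)
    fix E assume "E \<in> sets ?M"
    then have [measurable]: "E \<in> sets borel" using s by simp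
    have "emeasure ?M E = emeasure \<mu> (E \<inter> ?F)"
    proof -
      have "emeasure ?M E = (\<integral>\<^sup>+ r. indicator (E \<inter> ?F) r \<partial>\<mu>)"
        by (subst emeasure_density) (auto intro!: nn_integral_cong simp: indicator_def simp del: nn_integral_indicator)
      then show ?thesis by simp
    qed
    also have "\<dots> = (\<integral>\<^sup>+ r. exp_neg r * indicator (E \<inter> ?F) (- r) \<partial>\<mu>)"
      using assms(1) unfolding symmetric_dist_def by auto
    also have "\<dots> = (\<integral>\<^sup>+ r. exp_neg r * indicator ?F r * indicator (uminus -` E) r \<partial>\<mu>)"
      by (intro nn_integral_cong) (auto simp: indicator_def ereal_uminus_less_reorder split: if_splits)
    also have "\<dots> = emeasure ?N E"
    proof -
      have [measurable]: "uminus -` E \<in> sets borel"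
        using measurable_sets[of uminus borel borel E] by simp
      show ?thesis using sp s by (subst emeasure_distr) (auto simp: emeasure_density)
    qed
    finally show "emeasure ?M E = emeasure ?N E" .
  qed (simp add: s)
  then have "(\<integral>\<^sup>+r. f r \<partial>?M) = (\<integral>\<^sup>+r. f r \<partial>?N)" by simp
  moreover have "(\<integral>\<^sup>+r. f r \<partial>?M) = (\<integral>\<^sup>+r. f r \<partial>\<mu>)"
    using assms(3,4) by (subst nn_integral_density)
      (auto intro!: nn_integral_cong simp: indicator_def less_top[symmetric])
  moreover have "(\<integral>\<^sup>+r. f r \<partial>?N) = (\<integral>\<^sup>+r. exp_neg r * f (- r) \<partial>\<mu>)"
    using assms(3,4) by (subst nn_integral_distr, simp, simp, subst nn_integral_density)
      (auto intro!: nn_integral_cong simp: indicator_def less_top[symmetric])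
  ultimately show ?thesis by simp
qed

text \<open>Symmetry applied to the indicator of the finite points turns the integral of
  \<open>exp_neg\<close> into their total mass.\<close>

lemma symmetric_imp_LLR_dist:
  assumes "symmetric_dist \<mu>"
  shows "LLR_dist \<mu>"
proof -
  have l: "llr_line_dist \<mu>" using assms by (simp add: symmetric_dist_def)
  interpret prob_space \<mu> using llr_line_distD[OF l] by simp
  note [measurable_cong] = llr_line_distD(2)[OF l]
  have "(\<integral>\<^sup>+r. exp_neg r \<partial>\<mu>) = (\<integral>\<^sup>+r. exp_neg r * indicator finite_ereals (- r) \<partial>\<mu>)"
    using llr_line_distD(4)[OF l]
  proof (intro nn_integral_cong_AE, eventually_elim)
    case (elim r)
    then show ?case by (cases r) auto
  qed
  also have "\<dots> = (\<integral>\<^sup>+r. indicator finite_ereals r \<partial>\<mu>)"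
    by (rule symmetric_dist_nn_integral[symmetric, OF assms]) auto
  also have "\<dots> \<le> 1" by (simp add: emeasure_le_1)
  finally show ?thesis using l by (simp add: LLR_dist_def)
qed

text \<open>The reflected measure satisfies the characterization of the complement, which determines
  it uniquely.\<close>

lemma complement_dist_symmetric:
  assumes "symmetric_dist \<mu>"
  shows "complement_dist \<mu> = distr \<mu> borel uminus"
proof -
  have l: "llr_line_dist \<mu>" using assms by (simp add: symmetric_dist_def)
  note [measurable_cong] = llr_line_distD(2)[OF l]
  have "is_complement \<mu> (distr \<mu> borel uminus)"
    unfolding is_complement_def
  proof (intro conjI ballI impI)
    show "prob_space (distr \<mu> borel uminus)"
      using llr_line_distD(1)[OF l] by (rule prob_space.prob_space_distr) simp
    have "uminus -` {\<infinity>} = {-\<infinity> :: ereal}" by (auto simp: ereal_uminus_eq_reorder)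
    then show "emeasure (distr \<mu> borel uminus) {\<infinity>} = 0"
      using l by (subst emeasure_distr) (auto simp: llr_line_distD(3)[OF l] llr_line_dist_def)
  next
    fix E :: "ereal set" assume E [measurable]: "E \<in> sets borel" and "E \<subseteq> finite_ereals"
    then have "\<infinity> \<notin> E" "-\<infinity> \<notin> E" by auto
    then have "(\<integral>\<^sup>+r. indicator E (- r) \<partial>\<mu>) = (\<integral>\<^sup>+r. exp_neg r * indicator E (- (- r)) \<partial>\<mu>)"
      by (intro symmetric_dist_nn_integral[OF assms]) auto
    moreover have "emeasure (distr \<mu> borel uminus) E = (\<integral>\<^sup>+r. indicator E r \<partial>distr \<mu> borel uminus)"
      by simp
    moreover have "\<dots> = (\<integral>\<^sup>+r. indicator E (- r) \<partial>\<mu>)"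
      by (rule nn_integral_distr) auto
    ultimately show "emeasure (distr \<mu> borel uminus) E = (\<integral>\<^sup>+ r. exp_neg r * indicator E r \<partial>\<mu>)"
      by simp
  qed simp
  then show ?thesis
    using complement_ex1 is_complement_complement_dist symmetric_imp_LLR_dist[OF assms] by blast
qed

section \<open>The functional \<open>V_of\<close>\<close>

lemma LLR_distD:
  assumes "LLR_dist \<mu>"
  shows "prob_space \<mu>" "sets \<mu> = sets borel" "space \<mu> = UNIV" "AE r in \<mu>. r \<noteq> -\<infinity>"
    "prob_space (complement_dist \<mu>)" "sets (complement_dist \<mu>) = sets borel"
  using assms llr_line_distD[of \<mu>] is_complement_complement_dist[OF assms]
  by (auto simp: LLR_dist_def is_complement_def)

lemma ennreal_half_plus_half: "x / 2 + x / 2 = (x :: ennreal)"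
  using mult_divide_eq_ennreal[of 2 x] by (simp add: add_divide_distrib_ennreal[symmetric] mult_2_right)

lemma V_of_eq:
  assumes "LLR_dist \<mu>"
  shows "V_of \<mu> = (\<integral>\<^sup>+r. info r \<partial>\<mu>) / 2 + (\<integral>\<^sup>+r. info r \<partial>complement_dist \<mu>) / 2"
proof -
  have N: "(\<lambda>b. if b then \<mu> else complement_dist \<mu>) \<in> measurable (measure_pmf (bernoulli_pmf (1/2))) (subprob_algebra borel)"
    using LLR_distD[OF assms]
    by (auto simp: measurable_def space_subprob_algebra prob_space_imp_subprob_space)
  have half: "ennreal (1 / 2) = inverse 2"
    using divide_ennreal[of 1 2] by (simp add: divide_ennreal_def)
  show ?thesis
    unfolding V_of_def half_mix_def info_def[symmetric]
    by (subst nn_integral_bind[OF _ N]) (auto simp: divide_ennreal_def half)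
qed

lemma nn_integral_info_le:
  assumes "prob_space \<mu>"
  shows "(\<integral>\<^sup>+r. info r \<partial>\<mu>) \<le> 4"
proof -
  interpret prob_space \<mu> by fact
  have "(\<integral>\<^sup>+r. info r \<partial>\<mu>) \<le> (\<integral>\<^sup>+r. 4 \<partial>\<mu>)"
    by (intro nn_integral_mono) (metis ennreal_leI ennreal_numeral info_le)
  then show ?thesis by (simp add: emeasure_space_1)
qed

lemma V_of_le:
  assumes "LLR_dist \<mu>"
  shows "V_of \<mu> \<le> 4"
proof -
  have "V_of \<mu> \<le> 4 / 2 + 4 / 2"
    unfolding V_of_eq[OF assms] using LLR_distD[OF assms]
    by (intro add_mono divide_right_mono_ennreal nn_integral_info_le) auto
  then show ?thesis by (simp add: ennreal_half_plus_half)
qed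

lemma V_of_symmetric:
  assumes "symmetric_dist \<mu>"
  shows "V_of \<mu> = (\<integral>\<^sup>+r. info r \<partial>\<mu>)"
proof -
  note LLR = symmetric_imp_LLR_dist[OF assms]
  note [measurable_cong] = LLR_distD(2)[OF LLR]
  have "(\<integral>\<^sup>+r. info r \<partial>complement_dist \<mu>) = (\<integral>\<^sup>+r. info r \<partial>\<mu>)"
    unfolding complement_dist_symmetric[OF assms] by (subst nn_integral_distr) auto
  then show ?thesis
    by (simp add: V_of_eq[OF LLR] ennreal_half_plus_half)
qed

lemma trivial_distI:
  assumes "prob_space \<mu>" and s [measurable_cong]: "sets \<mu> = sets borel" and ae: "AE r in \<mu>. r = 0"
  shows "\<mu> = trivial_dist"
proof (rule measure_eqI)
  interpret prob_space \<mu> by fact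
  fix E assume "E \<in> sets \<mu>"
  then have E [measurable]: "E \<in> sets borel" using s by simp
  have "emeasure \<mu> E = (\<integral>\<^sup>+r. indicator E r \<partial>\<mu>)" using E s by simp
  also have "\<dots> = (\<integral>\<^sup>+r. indicator E 0 \<partial>\<mu>)"
    by (rule nn_integral_cong_AE) (use ae in eventually_elim, auto)
  also have "\<dots> = emeasure trivial_dist E" by (simp add: emeasure_space_1 trivial_dist_def)
  finally show "emeasure \<mu> E = emeasure trivial_dist E" .
qed (simp add: s trivial_dist_def)

lemma symmetric_trivial_dist: "symmetric_dist trivial_dist"
proof -
  have "exp_neg 0 = 1" by (simp add: exp_neg_def)
  then show ?thesis
    unfolding symmetric_dist_def llr_line_dist_def trivial_dist_def
    by (auto simp: nn_integral_return prob_space_return)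
qed

text \<open>\<open>info\<close> vanishes only at \<open>0\<close>, so the \<open>\<mu>\<close> half
  of the mixture already forces all mass to \<open>0\<close>. Non-triviality thereby becomes
  positivity of a number.\<close>

lemma V_of_eq_0_iff:
  assumes "LLR_dist \<mu>"
  shows "V_of \<mu> = 0 \<longleftrightarrow> \<mu> = trivial_dist"
proof
  note [measurable_cong] = LLR_distD(2)[OF assms]
  assume "V_of \<mu> = 0"
  then have "(\<integral>\<^sup>+r. info r \<partial>\<mu>) = 0"
    by (simp add: V_of_eq[OF assms] ennreal_divide_eq_0_iff)
  then have "AE r in \<mu>. r = 0"
    by (subst (asm) nn_integral_0_iff_AE) (auto simp: ennreal_eq_0_iff antisym[OF _ info_nonneg] info_eq_0_iff[symmetric])
  then show "\<mu> = trivial_dist" using LLR_distD[OF assms] by (intro trivial_distI)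
next
  assume "\<mu> = trivial_dist"
  then show "V_of \<mu> = 0"
    by (simp add: V_of_symmetric symmetric_trivial_dist) (simp add: trivial_dist_def nn_integral_return)
qed

lemma symmetric_distI:
  assumes "llr_line_dist \<mu>"
    and "\<And>f. f \<in> borel_measurable borel \<Longrightarrow> f \<infinity> = 0 \<Longrightarrow> f (-\<infinity>) = 0 \<Longrightarrow>
      (\<integral>\<^sup>+r. f r \<partial>\<mu>) = (\<integral>\<^sup>+r. exp_neg r * f (- r) \<partial>\<mu>)"
  shows "symmetric_dist \<mu>"
  unfolding symmetric_dist_def
proof (intro conjI ballI impI)
  fix E :: "ereal set" assume E: "E \<in> sets borel" and "E \<subseteq> finite_ereals"
  then have "\<infinity> \<notin> E" "-\<infinity> \<notin> E" by auto
  then show "emeasure \<mu> E = (\<integral>\<^sup>+ r. exp_neg r * indicator E (- r) \<partial>\<mu>)"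
    using assms(2)[of "indicator E"] E llr_line_distD(2)[OF assms(1)] by auto
qed fact

section \<open>Symmetrization of integrands\<close>

text \<open>Averaging with the weighted mirror image keeps integrals against symmetric
  distributions; the atom at \<open>\<infinity>\<close> has no mirror image and keeps its value. For
  a fixed negative \<open>r\<close> the plain value \<open>gauss_info s r\<close> can decrease in
  \<open>s\<close>, because the positive drift first moves \<open>r\<close> towards
  \<open>0\<close>; monotonicity appears only after this averaging.\<close>

definition symmetrize :: "(ereal \<Rightarrow> ennreal) \<Rightarrow> ereal \<Rightarrow> ennreal" where
  "symmetrize k r = (if r = \<infinity> then k \<infinity> else (k r + exp_neg r * k (- r)) / 2)"

lemma nn_integral_symmetrize:
  assumes sym: "symmetric_dist \<mu>" and k [measurable]: "k \<in> borel_measurable borel"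
  shows "(\<integral>\<^sup>+r. k r \<partial>\<mu>) = (\<integral>\<^sup>+r. symmetrize k r \<partial>\<mu>)"
proof -
  have l: "llr_line_dist \<mu>" using sym by (simp add: symmetric_dist_def)
  note [measurable_cong] = llr_line_distD(2)[OF l]
  \<comment> \<open>Cut off at both infinities, \<open>k\<close> becomes admissible for
    \<open>symmetric_dist_nn_integral\<close>; the atom at \<open>\<infinity>\<close> is carried
    separately.\<close>
  let ?k = "\<lambda>r. if \<bar>r\<bar> = \<infinity> then 0 else k r"
  have eq: "(\<integral>\<^sup>+r. ?k r \<partial>\<mu>) = (\<integral>\<^sup>+r. exp_neg r * ?k (- r) \<partial>\<mu>)"
    by (rule symmetric_dist_nn_integral[OF sym]) auto
  have "(\<integral>\<^sup>+r. k r \<partial>\<mu>) = (\<integral>\<^sup>+r. k \<infinity> * indicator {\<infinity>} r + ?k r \<partial>\<mu>)"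
    using llr_line_distD(4)[OF l]
  proof (intro nn_integral_cong_AE, eventually_elim)
    case (elim r)
    then show ?case by (cases r) (auto simp: indicator_def)
  qed
  also have "\<dots> = (\<integral>\<^sup>+r. k \<infinity> * indicator {\<infinity>} r \<partial>\<mu>) + (\<integral>\<^sup>+r. ?k r \<partial>\<mu>)"
    by (rule nn_integral_add) auto
  also have "(\<integral>\<^sup>+r. ?k r \<partial>\<mu>) = (\<integral>\<^sup>+r. ?k r \<partial>\<mu>) / 2 + (\<integral>\<^sup>+r. exp_neg r * ?k (- r) \<partial>\<mu>) / 2"
    unfolding eq[symmetric] by (rule ennreal_half_plus_half[symmetric])
  also have "\<dots> = (\<integral>\<^sup>+r. ?k r / 2 + exp_neg r * ?k (- r) / 2 \<partial>\<mu>)"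
    by (subst nn_integral_add) (auto simp: nn_integral_divide)
  also have "(\<integral>\<^sup>+r. k \<infinity> * indicator {\<infinity>} r \<partial>\<mu>) + (\<integral>\<^sup>+r. ?k r / 2 + exp_neg r * ?k (- r) / 2 \<partial>\<mu>)
      = (\<integral>\<^sup>+r. k \<infinity> * indicator {\<infinity>} r + (?k r / 2 + exp_neg r * ?k (- r) / 2) \<partial>\<mu>)"
    by (rule nn_integral_add[symmetric]) auto
  also have "\<dots> = (\<integral>\<^sup>+r. symmetrize k r \<partial>\<mu>)"
    using llr_line_distD(4)[OF l]
  proof (intro nn_integral_cong_AE, eventually_elim)
    case (elim r)
    then show ?case
      by (cases r) (auto simp: symmetrize_def indicator_def add_divide_distrib_ennreal)
  qed
  finally show ?thesis .
qed

section \<open>Information after adding Gaussian noise\<close>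

definition gauss_info :: "ennreal \<Rightarrow> ereal \<Rightarrow> ennreal" where
  "gauss_info s r = (\<integral>\<^sup>+z. info (gauss_map s z + r) \<partial>std_gauss)"

lemma gauss_info_measurable [measurable]:
  assumes [measurable]: "f \<in> borel_measurable M" "g \<in> borel_measurable M"
  shows "(\<lambda>x. gauss_info (f x) (g x)) \<in> borel_measurable M"
proof -
  interpret sigma_finite_measure std_gauss by unfold_locales
  show ?thesis unfolding gauss_info_def by measurable
qed

lemma gauss_info_top [simp]: "gauss_info \<infinity> r = 4" "gauss_info top r = 4"
  by (simp_all add: gauss_info_def)

lemma gauss_info_infinity [simp]: "gauss_info s \<infinity> = 4"
  by (simp add: gauss_info_def)

lemma gauss_info_le: "gauss_info s r \<le> 4"
proof -
  have "gauss_info s r \<le> (\<integral>\<^sup>+z. 4 \<partial>std_gauss)"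
    unfolding gauss_info_def by (intro nn_integral_mono) (metis ennreal_leI ennreal_numeral info_le)
  then show ?thesis by simp
qed

lemma gauss_info_finite:
  assumes "s \<noteq> \<infinity>"
  shows "gauss_info s (ereal x) = ennreal (4 * shifted_tanh_sq (sqrt (enn2real s) / 2) (x / 2))"
proof -
  define t where "t = sqrt (enn2real s) / 2"
  have t: "enn2real s = 4 * t\<^sup>2" "sqrt (enn2real s) = 2 * t" by (auto simp: t_def power_divide)
  have *: "(enn2real s / 2 + sqrt (enn2real s) * z + x) / 2 = x / 2 + t\<^sup>2 + t * z" for z
    unfolding t(2) unfolding t(1) by (simp add: add_divide_distrib)
  have "integrable std_gauss (\<lambda>z. (tanh (x / 2 + t\<^sup>2 + t * z))\<^sup>2)"
    by (rule integrable_gauss_bounded[where B = 1]) (auto simp: abs_square_le_1)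
  then show ?thesis
    unfolding gauss_info_def gauss_map_def shifted_tanh_sq_def using assms
    by (simp add: * t_def[symmetric] nn_integral_eq_integral)
qed

text \<open>Put \<open>x = 2 * y\<close> and split \<open>exp (- x) = exp (- y) * exp (- y)\<close>:
  one factor comes out, the other balances the two signs as in \<open>tilted_info_eq\<close>. The
  factor taken out is positive and free of \<open>s\<close>, so monotonicity and the ratio bound
  carry over from \<open>tilted_info\<close>.\<close>

lemma symmetrize_gauss_info_finite:
  assumes "s \<noteq> \<infinity>"
  shows "symmetrize (gauss_info s) (ereal x)
    = ennreal (4 * exp (- x / 2) * tilted_info (sqrt (enn2real s) / 2) (x / 2))"
proof -
  define t y where "t = sqrt (enn2real s) / 2" and "y = x / 2"
  have e: "exp (- x) = exp (- y) * exp (- y)" by (simp add: y_def exp_add[symmetric])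
  have e': "exp (- y) * exp y = 1" by (simp add: exp_add[symmetric])
  have nn: "0 \<le> shifted_tanh_sq t u" for u
    by (simp add: shifted_tanh_sq_def)
  have "symmetrize (gauss_info s) (ereal x)
     = (ennreal (4 * shifted_tanh_sq t y) + ennreal (exp (- x)) * ennreal (4 * shifted_tanh_sq t (- y))) / 2"
    using gauss_info_finite[OF assms, of x] gauss_info_finite[OF assms, of "- x"]
    by (simp add: symmetrize_def t_def y_def)
  also have "\<dots> = ennreal ((4 * shifted_tanh_sq t y + exp (- x) * (4 * shifted_tanh_sq t (- y))) / 2)"
    using nn by (simp add: ennreal_mult divide_ennreal[symmetric])
  also have "(4 * shifted_tanh_sq t y + exp (- x) * (4 * shifted_tanh_sq t (- y))) / 2
     = 2 * exp (- y) * (exp y * shifted_tanh_sq t y + exp (- y) * shifted_tanh_sq t (- y))"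
    unfolding e distrib_left using e' by (simp add: mult.assoc[symmetric])
  also have "\<dots> = 4 * exp (- y) * tilted_info t y"
    unfolding tilted_info_eq by simp
  finally show ?thesis by (simp add: t_def y_def)
qed

lemma symmetrize_gauss_info_mono:
  assumes "s \<le> s'" "r \<noteq> -\<infinity>"
  shows "symmetrize (gauss_info s) r \<le> symmetrize (gauss_info s') r"
proof (cases "s' = \<infinity>")
  case True
  then show ?thesis
    by (auto simp: symmetrize_def gauss_info_le intro!: divide_right_mono_ennreal add_mono mult_left_mono)
next
  case False
  with assms have s: "s \<noteq> \<infinity>" by (auto simp: top_unique)
  have "sqrt (enn2real s) / 2 \<le> sqrt (enn2real s') / 2"
    using assms False by (auto intro!: enn2real_mono simp: less_top)
  then show ?thesis
  proof (cases r)
    case (real x)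
    then show ?thesis
      using \<open>sqrt (enn2real s) / 2 \<le> _\<close> False s
      by (simp add: symmetrize_gauss_info_finite ennreal_leI tilted_info_mono)
  qed (use assms(2) in \<open>auto simp: symmetrize_def\<close>)
qed

text \<open>For finite \<open>r\<close> and \<open>d\<close> this is
  \<open>tilted_info_ratio\<close> at \<open>t\<^sup>2 = d * v / 4\<close> and
  \<open>d * w / 4\<close>. If \<open>r\<close> or \<open>d\<close> is infinite, the same positive
  finite constant stands on both sides and \<open>v < w\<close> decides.\<close>

lemma symmetrize_gauss_info_ratio:
  assumes v: "0 < v" "v < w" and d: "0 < d" and r: "r \<noteq> -\<infinity>"
  shows "ennreal v * symmetrize (gauss_info (d * ennreal w)) r < ennreal w * symmetrize (gauss_info (d * ennreal v)) r"
proof (cases "r = \<infinity>")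
  case True
  then show ?thesis using v by (simp add: symmetrize_def ennreal_less_iff flip: ennreal_mult ennreal_numeral)
next
  case False
  with r obtain x where x: "r = ereal x" by (cases r) auto
  show ?thesis
  proof (cases "d = \<infinity>")
    case True
    define c where "c = symmetrize (gauss_info \<infinity>) r"
    have "c = ennreal ((4 + exp (- x) * 4) / 2)"
      by (simp add: c_def symmetrize_def x ennreal_mult divide_ennreal[symmetric])
    moreover have "0 < (4 + exp (- x) * 4) / 2" by (simp add: add_pos_pos)
    ultimately have "ennreal v * c < ennreal w * c"
      using v by (simp add: ennreal_mult[symmetric] ennreal_less_iff del: ennreal_plus)
    then show ?thesis using True v by (simp add: c_def ennreal_top_mult)
  next
    case False
    then obtain D where D: "d = ennreal D" "0 < D"
      using d by (cases d) (auto simp: ennreal_less_iff)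
    define a b where "a = sqrt (D * v) / 2" and "b = sqrt (D * w) / 2"
    have ab: "0 < a" "a < b" using D v by (auto simp: a_def b_def)
    have sq: "a\<^sup>2 = D * v / 4" "b\<^sup>2 = D * w / 4"
      using D v by (auto simp: a_def b_def power_divide)
    have "v * tilted_info b (x / 2) < w * tilted_info a (x / 2)"
      using tilted_info_ratio[OF ab, of "x / 2"] D v by (simp add: sq field_simps)
    then have "v * (4 * exp (- x / 2) * tilted_info b (x / 2)) < w * (4 * exp (- x / 2) * tilted_info a (x / 2))"
      by (simp add: mult.left_commute[of v] mult.left_commute[of w] mult.assoc)
    moreover have "0 \<le> tilted_info b (x / 2)"
    proof -
      have "0 \<le> tilted_info 0 (x / 2)"
        by (simp add: tilted_info_def order_trans[OF sech_le_1 cosh_real_ge_1])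
      also have "\<dots> \<le> tilted_info b (x / 2)"
        using ab by (intro tilted_info_mono) auto
      finally show ?thesis .
    qed
    ultimately have "ennreal v * ennreal (4 * exp (- x / 2) * tilted_info b (x / 2))
       < ennreal w * ennreal (4 * exp (- x / 2) * tilted_info a (x / 2))"
      using v by (subst (1 2) ennreal_mult'[symmetric]) (auto simp: ennreal_less_iff)
    then show ?thesis
      using D v by (simp add: x symmetrize_gauss_info_finite a_def b_def flip: ennreal_mult)
  qed
qed

text \<open>At \<open>y = 0\<close> the two signs coincide, so the value is
  \<open>4 * tilted_info t 0\<close> with \<open>t\<^sup>2 = s / 4\<close>.\<close>

lemma gauss_info_0_less:
  assumes "s \<noteq> 0"
  shows "gauss_info s 0 < s"
proof (cases "s = \<infinity>")
  case False
  then have s: "0 < enn2real s" using assms by (auto simp: enn2real_positive_iff less_top zero_less_iff_neq_zero)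
  have "gauss_info s 0 = ennreal (4 * tilted_info (sqrt (enn2real s) / 2) 0)"
    using gauss_info_finite[OF False, of 0] tilted_info_eq[of 0 "sqrt (enn2real s) / 2"]
    by (simp add: zero_ereal_def[symmetric])
  also have "\<dots> < ennreal (enn2real s)"
    using tilted_info_less_square[of "sqrt (enn2real s) / 2"] s
    by (intro ennreal_lessI) (auto simp: power_divide)
  finally show ?thesis using False by (simp add: less_top)
qed simp

section \<open>The scalar map\<close>

locale large_degree_bp =
  fixes P :: "ennreal measure" and \<mu>s :: "ereal measure"
  assumes prob_P: "prob_space P" and sets_P [measurable_cong]: "sets P = sets borel"
    and symmetric_s: "symmetric_dist \<mu>s"
begin

sublocale P: prob_space P by (rule prob_P)

lemma line_s: "llr_line_dist \<mu>s"
  using symmetric_s by (simp add: symmetric_dist_def)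

sublocale S: prob_space \<mu>s
  using llr_line_distD[OF line_s] by simp

lemma sets_s [measurable_cong]: "sets \<mu>s = sets borel"
  using llr_line_distD[OF line_s] by simp

lemma AE_s: "AE r in \<mu>s. r \<noteq> -\<infinity>"
  using llr_line_distD[OF line_s] by simp

lemma space_P [simp]: "space P = UNIV"
  using sets_eq_imp_space_eq[OF sets_P] by simp

sublocale PG: pair_prob_space P std_gauss ..

sublocale SPG: pair_prob_space \<mu>s "P \<Otimes>\<^sub>M std_gauss" ..

section \<open>The output law of the operator\<close>

definition bp_var :: "ennreal \<Rightarrow> ereal \<times> ennreal \<times> real \<Rightarrow> ereal" where
  "bp_var v = (\<lambda>(r, d, z). gauss_map (d * v) z + r)"

definition bp_map :: "ennreal \<Rightarrow> ereal measure" where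
  "bp_map v = distr (\<mu>s \<Otimes>\<^sub>M (P \<Otimes>\<^sub>M std_gauss)) borel (bp_var v)"

lemma bp_var_measurable [measurable]: "bp_var v \<in> borel_measurable (\<mu>s \<Otimes>\<^sub>M (P \<Otimes>\<^sub>M std_gauss))"
  unfolding bp_var_def by measurable

lemma sets_bp_map [simp, measurable_cong]: "sets (bp_map v) = sets borel"
  by (simp add: bp_map_def)

lemma prob_bp_map: "prob_space (bp_map v)"
  unfolding bp_map_def by (rule SPG.prob_space_distr) simp

lemma nn_integral_bp_map:
  assumes [measurable]: "f \<in> borel_measurable borel"
  shows "(\<integral>\<^sup>+x. f x \<partial>bp_map v) = (\<integral>\<^sup>+r. \<integral>\<^sup>+d. \<integral>\<^sup>+z. f (gauss_map (d * v) z + r) \<partial>std_gauss \<partial>P \<partial>\<mu>s)"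
proof -
  have "(\<integral>\<^sup>+x. f x \<partial>bp_map v) = (\<integral>\<^sup>+\<omega>. f (bp_var v \<omega>) \<partial>(\<mu>s \<Otimes>\<^sub>M (P \<Otimes>\<^sub>M std_gauss)))"
    unfolding bp_map_def by (rule nn_integral_distr) auto
  also have "\<dots> = (\<integral>\<^sup>+r. \<integral>\<^sup>+p. f (bp_var v (r, p)) \<partial>(P \<Otimes>\<^sub>M std_gauss) \<partial>\<mu>s)"
    by (rule PG.P.nn_integral_fst[symmetric]) auto
  also have "\<dots> = (\<integral>\<^sup>+r. \<integral>\<^sup>+d. \<integral>\<^sup>+z. f (gauss_map (d * v) z + r) \<partial>std_gauss \<partial>P \<partial>\<mu>s)"
    by (intro nn_integral_cong, subst gauss.nn_integral_fst[symmetric]) (auto simp: bp_var_def)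
  finally show ?thesis .
qed

text \<open>Fubini and the integral formula for mixtures bring both sides to the same iterated
  integral.\<close>

lemma Q_L_eq_bp_map: "Q_L P \<mu>s \<mu> = bp_map (V_of \<mu>)"
proof (rule measure_eqI)
  let ?N = "\<lambda>d. gaussian_llr (d * V_of \<mu>)"
  let ?B = "P \<bind> ?N"
  have N [measurable]: "?N \<in> P \<rightarrow>\<^sub>M subprob_algebra borel" by simp
  have sets_B [measurable_cong, simp]: "sets ?B = sets borel"
    by (rule sets_bind[OF sets_kernel[OF N]]) auto
  have "prob_space ?B"
  proof (rule P.prob_space_bind[OF _ N])
    have "emeasure (gaussian_llr s) UNIV = 1" for s
      using nn_integral_gaussian_llr[of "\<lambda>_. 1" s]
      by (simp add: sets_eq_imp_space_eq[OF sets_kernel[OF gaussian_llr_measurable]])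
    then have "prob_space (gaussian_llr s)" for s
      by (intro prob_spaceI) (simp add: sets_eq_imp_space_eq[OF sets_kernel[OF gaussian_llr_measurable]])
    then show "AE x in P. prob_space (?N x)" by simp
  qed
  then interpret B: prob_space ?B .
  interpret BS: pair_prob_space ?B \<mu>s ..
  fix E assume "E \<in> sets (Q_L P \<mu>s \<mu>)"
  then have [measurable]: "E \<in> sets borel" by (simp add: Q_L_def conv_ereal_def)
  have "emeasure (Q_L P \<mu>s \<mu>) E = (\<integral>\<^sup>+x. indicator E x \<partial>distr (?B \<Otimes>\<^sub>M \<mu>s) borel (\<lambda>(x, y). x + y))"
    by (simp add: Q_L_def conv_ereal_def)
  also have "\<dots> = (\<integral>\<^sup>+p. indicator E (fst p + snd p) \<partial>(?B \<Otimes>\<^sub>M \<mu>s))"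
    by (subst nn_integral_distr) (auto simp: case_prod_beta)
  also have "\<dots> = (\<integral>\<^sup>+r. \<integral>\<^sup>+u. indicator E (u + r) \<partial>?B \<partial>\<mu>s)"
    by (subst BS.nn_integral_snd[symmetric]) auto
  also have "\<dots> = (\<integral>\<^sup>+r. \<integral>\<^sup>+d. \<integral>\<^sup>+u. indicator E (u + r) \<partial>?N d \<partial>P \<partial>\<mu>s)"
    by (intro nn_integral_cong nn_integral_bind[OF _ N]) auto
  also have "\<dots> = (\<integral>\<^sup>+r. \<integral>\<^sup>+d. \<integral>\<^sup>+z. indicator E (gauss_map (d * V_of \<mu>) z + r) \<partial>std_gauss \<partial>P \<partial>\<mu>s)"
    by (intro nn_integral_cong nn_integral_gaussian_llr) auto
  also have "\<dots> = emeasure (bp_map (V_of \<mu>)) E"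
    by (subst nn_integral_bp_map[symmetric]) auto
  finally show "emeasure (Q_L P \<mu>s \<mu>) E = emeasure (bp_map (V_of \<mu>)) E" .
qed (simp add: Q_L_def conv_ereal_def)

lemma AE_bp_map: "AE x in bp_map v. x \<noteq> -\<infinity>"
proof -
  have "(\<integral>\<^sup>+x. indicator {-\<infinity>} x \<partial>bp_map v)
      = (\<integral>\<^sup>+r. \<integral>\<^sup>+d. \<integral>\<^sup>+z. indicator {-\<infinity>} (gauss_map (d * v) z + r) \<partial>std_gauss \<partial>P \<partial>\<mu>s)"
    by (rule nn_integral_bp_map) simp
  also have "\<dots> = (\<integral>\<^sup>+r. 0 \<partial>\<mu>s)"
  proof (rule nn_integral_cong_AE)
    show "AE r in \<mu>s. (\<integral>\<^sup>+d. \<integral>\<^sup>+z. indicator {-\<infinity>} (gauss_map (d * v) z + r) \<partial>std_gauss \<partial>P) = 0"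
      using AE_s
    proof eventually_elim
      case (elim r)
      then have "gauss_map s z + r \<noteq> -\<infinity>" for s z
        by (simp add: ereal_plus_eq_MInfty)
      then show ?case by simp
    qed
  qed
  finally show ?thesis
    by (intro AE_I[of _ _ "{-\<infinity>}"]) auto
qed

text \<open>Symmetry is used twice: for \<open>\<mu>s\<close>, which reflects \<open>r\<close>, and
  then for the Gaussian at each fixed \<open>d\<close>, which reflects the noise. The two
  exponential weights multiply to the weight of the sum.\<close>

lemma symmetric_bp_map: "symmetric_dist (bp_map v)"
proof (rule symmetric_distI)
  show "llr_line_dist (bp_map v)"
    unfolding llr_line_dist_def using prob_bp_map AE_bp_map[of v]
    by (auto simp: AE_iff_measurable[OF _ refl] prob_bp_map AE_iff_null null_sets_def sets_eq_imp_space_eq[OF sets_bp_map])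
next
  fix f :: "ereal \<Rightarrow> ennreal"
  assume f [measurable]: "f \<in> borel_measurable borel" and f0: "f \<infinity> = 0" "f (-\<infinity>) = 0"
  define k where "k r = (\<integral>\<^sup>+d. \<integral>\<^sup>+z. f (gauss_map (d * v) z + r) \<partial>std_gauss \<partial>P)" for r
  have [measurable]: "k \<in> borel_measurable borel" unfolding k_def by measurable
  \<comment> \<open>In \<open>ereal\<close> this sum is \<open>\<infinity>\<close> or
    \<open>-\<infinity>\<close>, and \<open>f\<close> vanishes at both.\<close>
  have "f (gauss_map s z + - \<infinity>) = 0" for s z
    using f0 by (cases "gauss_map s z") auto
  then have k0: "k \<infinity> = 0" "k (-\<infinity>) = 0" by (auto simp: k_def f0)
  have "(\<integral>\<^sup>+x. f x \<partial>bp_map v) = (\<integral>\<^sup>+r. k r \<partial>\<mu>s)"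
    by (simp add: nn_integral_bp_map k_def)
  also have "\<dots> = (\<integral>\<^sup>+r. exp_neg r * k (- r) \<partial>\<mu>s)"
    by (rule symmetric_dist_nn_integral[OF symmetric_s]) (auto simp: k0)
  also have "\<dots> = (\<integral>\<^sup>+r. \<integral>\<^sup>+d. \<integral>\<^sup>+z. exp_neg (gauss_map (d * v) z + r) * f (- (gauss_map (d * v) z + r)) \<partial>std_gauss \<partial>P \<partial>\<mu>s)"
    using AE_s
  proof (intro nn_integral_cong_AE, eventually_elim)
    case (elim r)
    show ?case
    proof (cases r)
      case (real x)
      have "exp_neg r * (\<integral>\<^sup>+z. f (gauss_map s z - r) \<partial>std_gauss)
        = (\<integral>\<^sup>+z. exp_neg (gauss_map s z + r) * f (- (gauss_map s z + r)) \<partial>std_gauss)" for s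
      proof (cases "s = \<infinity>")
        case False
        define m where "m = sqrt (enn2real s)"
        have m: "gauss_map s z = ereal (m\<^sup>2 / 2 + m * z)" for z
          using False by (simp add: gauss_map_def m_def)
        have *: "exp_neg r * (ennreal (exp (- u)) * f (ereal (- u) - r)) = exp_neg (ereal u + r) * f (- (ereal u + r))" for u
        proof -
          have "ennreal (exp (- x)) * ennreal (exp (- u)) = ennreal (exp (- (u + x)))"
            by (simp only: ennreal_mult[symmetric] exp_ge_zero exp_add[symmetric]) simp
          then show ?thesis by (simp add: real mult.assoc[symmetric])
        qed
        have "(\<integral>\<^sup>+z. f (gauss_map s z - r) \<partial>std_gauss)
           = (\<integral>\<^sup>+z. ennreal (exp (- (m\<^sup>2 / 2 + m * z))) * f (ereal (- (m\<^sup>2 / 2 + m * z)) - r) \<partial>std_gauss)"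
          unfolding m by (rule nn_integral_gauss_symmetric[of "\<lambda>x. f (ereal x - r)" m]) measurable
        then have "exp_neg r * (\<integral>\<^sup>+z. f (gauss_map s z - r) \<partial>std_gauss)
           = (\<integral>\<^sup>+z. exp_neg r * (ennreal (exp (- (m\<^sup>2 / 2 + m * z))) * f (ereal (- (m\<^sup>2 / 2 + m * z)) - r)) \<partial>std_gauss)"
          by (simp only:) (rule nn_integral_cmult[symmetric], measurable)
        then show ?thesis unfolding m * .
      qed (simp add: f0 real)
      then show ?thesis
        unfolding k_def by (subst nn_integral_cmult[symmetric]) (auto simp: minus_ereal_def intro!: nn_integral_cong)
    qed (use elim in \<open>auto simp: k0 f0\<close>)
  qed
  also have "\<dots> = (\<integral>\<^sup>+x. exp_neg x * f (- x) \<partial>bp_map v)"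
    by (rule nn_integral_bp_map[symmetric]) simp
  finally show "(\<integral>\<^sup>+x. f x \<partial>bp_map v) = (\<integral>\<^sup>+x. exp_neg x * f (- x) \<partial>bp_map v)" .
qed

lemma LLR_bp_map: "LLR_dist (bp_map v)"
  by (rule symmetric_imp_LLR_dist[OF symmetric_bp_map])

section \<open>Monotonicity and decreasing ratio of the scalar map\<close>

definition V_map :: "ennreal \<Rightarrow> ennreal" where
  "V_map v = V_of (bp_map v)"

lemma V_map_le: "V_map v \<le> 4"
  unfolding V_map_def by (rule V_of_le[OF LLR_bp_map])

lemma V_map_eq: "V_map v = (\<integral>\<^sup>+r. \<integral>\<^sup>+d. gauss_info (d * v) r \<partial>P \<partial>\<mu>s)"
  unfolding V_map_def V_of_symmetric[OF symmetric_bp_map] gauss_info_def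
  by (rule nn_integral_bp_map) simp

text \<open>Symmetrization is linear in the integrand, so it commutes with averaging over
  \<open>d\<close>. In this form the pointwise estimates can be integrated.\<close>

lemma V_map_eq_symmetrized: "V_map v = (\<integral>\<^sup>+r. \<integral>\<^sup>+d. symmetrize (gauss_info (d * v)) r \<partial>P \<partial>\<mu>s)"
proof -
  have "V_map v = (\<integral>\<^sup>+r. symmetrize (\<lambda>r. \<integral>\<^sup>+d. gauss_info (d * v) r \<partial>P) r \<partial>\<mu>s)"
    unfolding V_map_eq by (rule nn_integral_symmetrize[OF symmetric_s]) simp
  moreover have "symmetrize (\<lambda>r. \<integral>\<^sup>+d. gauss_info (d * v) r \<partial>P) r
      = (\<integral>\<^sup>+d. symmetrize (gauss_info (d * v)) r \<partial>P)" for r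
    unfolding symmetrize_def
    by (auto simp: nn_integral_add nn_integral_cmult nn_integral_divide)
  ultimately show ?thesis by simp
qed

lemma symmetrize_gauss_info_measurable [measurable]:
  "(\<lambda>(r, d). symmetrize (gauss_info (d * v)) r) \<in> borel_measurable (\<mu>s \<Otimes>\<^sub>M P)"
  unfolding symmetrize_def by measurable

lemma symmetrize_gauss_info_measurable' [measurable]:
  "(\<lambda>d. symmetrize (gauss_info (d * v)) r) \<in> borel_measurable P"
  unfolding symmetrize_def by measurable

lemma V_map_mono:
  assumes "v \<le> w"
  shows "V_map v \<le> V_map w"
  unfolding V_map_eq_symmetrized using AE_s
  by (intro nn_integral_mono_AE, eventually_elim)
    (intro nn_integral_mono symmetrize_gauss_info_mono mult_left_mono assms; simp)

text \<open>The pointwise strict inequality is integrated first over \<open>d\<close> and then over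
  \<open>r\<close>. It is strict wherever \<open>d > 0\<close>; if \<open>d = 0\<close> almost
  surely, the map is constant and its positivity gives strictness.\<close>

lemma V_map_ratio:
  assumes v: "0 < v" "v < w" and pos: "0 < V_map (ennreal w)"
  shows "ennreal v * V_map (ennreal w) < ennreal w * V_map (ennreal v)"
proof (cases "AE d in P. d = 0")
  case True
  have const: "V_map u = (\<integral>\<^sup>+r. gauss_info 0 r \<partial>\<mu>s)" for u
  proof -
    have "(\<integral>\<^sup>+d. gauss_info (d * u) r \<partial>P) = (\<integral>\<^sup>+d. gauss_info 0 r \<partial>P)" for r
      by (rule nn_integral_cong_AE) (use True in eventually_elim, simp)
    then show ?thesis by (simp add: V_map_eq P.emeasure_space_1[simplified])
  qed
  have "V_map (ennreal w) \<noteq> \<infinity>" using V_map_le[of "ennreal w"] by (auto simp: top_unique)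
  then obtain c where c: "V_map (ennreal w) = ennreal c" "0 < c"
    using pos by (cases "V_map (ennreal w)") (auto simp: ennreal_less_iff)
  have "V_map (ennreal v) = V_map (ennreal w)" unfolding const ..
  then show ?thesis using c v by (simp add: ennreal_mult[symmetric] ennreal_less_iff)
next
  case False
  define g where "g u r = (\<integral>\<^sup>+d. symmetrize (gauss_info (d * ennreal u)) r \<partial>P)" for u r
  have [measurable]: "g u \<in> borel_measurable \<mu>s" for u unfolding g_def by measurable
  have V: "V_map (ennreal u) = (\<integral>\<^sup>+r. g u r \<partial>\<mu>s)" for u
    unfolding V_map_eq_symmetrized g_def ..
  \<comment> \<open>A strict inequality survives integration only if the smaller integral is finite;
    the value for infinite signal is a finite bound.\<close>
  have g_fin: "g u r \<noteq> \<infinity>" if "r \<noteq> -\<infinity>" for u r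
  proof -
    have "symmetrize (gauss_info (d * ennreal u)) r \<le> symmetrize (gauss_info \<infinity>) r" for d
      using that by (intro symmetrize_gauss_info_mono) auto
    then have "g u r \<le> (\<integral>\<^sup>+d. symmetrize (gauss_info \<infinity>) r \<partial>P)"
      unfolding g_def by (intro nn_integral_mono)
    also have "\<dots> = symmetrize (gauss_info \<infinity>) r"
      by (simp add: P.emeasure_space_1[simplified])
    also have "\<dots> < \<infinity>"
      using that by (cases r) (auto simp: symmetrize_def ennreal_mult_less_top ennreal_divide_eq_top_iff less_top[symmetric] ennreal_mult_eq_top_iff)
    finally show ?thesis by simp
  qed
  have less: "ennreal v * g w r < ennreal w * g v r" if r: "r \<noteq> -\<infinity>" for r
  proof -
    have "(\<integral>\<^sup>+d. ennreal v * symmetrize (gauss_info (d * ennreal w)) r \<partial>P)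
        < (\<integral>\<^sup>+d. ennreal w * symmetrize (gauss_info (d * ennreal v)) r \<partial>P)"
    proof (rule nn_integral_less)
      show "(\<integral>\<^sup>+d. ennreal v * symmetrize (gauss_info (d * ennreal w)) r \<partial>P) \<noteq> \<infinity>"
        using g_fin[OF r, of w] by (subst nn_integral_cmult) (auto simp: g_def[symmetric] ennreal_mult_eq_top_iff)
      have le: "ennreal v * symmetrize (gauss_info (d * ennreal w)) r \<le> ennreal w * symmetrize (gauss_info (d * ennreal v)) r" for d
      proof (cases "d = 0")
        case True
        then show ?thesis using v by (auto intro!: mult_right_mono ennreal_leI)
      next
        case False
        then show ?thesis
          using v r by (intro less_imp_le symmetrize_gauss_info_ratio) (auto simp: zero_less_iff_neq_zero)
      qed
      then show "AE d in P. ennreal v * symmetrize (gauss_info (d * ennreal w)) r \<le> ennreal w * symmetrize (gauss_info (d * ennreal v)) r"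
        by simp
      \<comment> \<open>The reverse inequality can hold only at \<open>d = 0\<close>, and
        \<open>d\<close> is not almost surely \<open>0\<close> in this case.\<close>
      show "\<not> (AE d in P. ennreal w * symmetrize (gauss_info (d * ennreal v)) r \<le> ennreal v * symmetrize (gauss_info (d * ennreal w)) r)"
      proof
        assume "AE d in P. ennreal w * symmetrize (gauss_info (d * ennreal v)) r \<le> ennreal v * symmetrize (gauss_info (d * ennreal w)) r"
        then have "AE d in P. d = 0"
        proof eventually_elim
          case (elim d)
          show "d = 0"
          proof (rule ccontr)
            assume "d \<noteq> 0"
            then show False
              using symmetrize_gauss_info_ratio[OF v _ r, of d] elim by (auto simp: zero_less_iff_neq_zero)
          qed
        qed
        with False show False by simp
      qed
    qed auto
    then show ?thesis unfolding g_def by (simp add: nn_integral_cmult)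
  qed
  have "(\<integral>\<^sup>+r. ennreal v * g w r \<partial>\<mu>s) < (\<integral>\<^sup>+r. ennreal w * g v r \<partial>\<mu>s)"
  proof (rule nn_integral_less)
    show "(\<integral>\<^sup>+r. ennreal v * g w r \<partial>\<mu>s) \<noteq> \<infinity>"
      using V_map_le[of "ennreal w"]
      by (subst nn_integral_cmult) (auto simp: V[symmetric] ennreal_mult_eq_top_iff top_unique)
    show "AE r in \<mu>s. ennreal v * g w r \<le> ennreal w * g v r"
      using AE_s by eventually_elim (simp add: less less_imp_le)
    show "\<not> (AE r in \<mu>s. ennreal w * g v r \<le> ennreal v * g w r)"
    proof
      assume "AE r in \<mu>s. ennreal w * g v r \<le> ennreal v * g w r"
      with AE_s have "AE r in \<mu>s. False"
        by eventually_elim (use less in \<open>auto simp: not_le[symmetric]\<close>)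
      then show False using S.AE_False by simp
    qed
  qed auto
  then show ?thesis by (simp add: V nn_integral_cmult)
qed

end

section \<open>Iteration of monotone maps with decreasing ratio\<close>

text \<open>Continuity is required only inside the positive half-line: the scalar map may jump at
  \<open>0\<close> when \<open>P\<close> charges \<open>\<infinity>\<close>. The clause
  \<open>ratio\<close> says that \<open>F v / v\<close> is strictly decreasing while
  \<open>F\<close> is positive.\<close>

locale sublinear_map =
  fixes F :: "real \<Rightarrow> real" and c :: real
  assumes mono: "0 \<le> v \<Longrightarrow> v \<le> w \<Longrightarrow> F v \<le> F w"
    and nonneg: "0 \<le> F v" and le: "F v \<le> c"
    and cont: "0 < u \<Longrightarrow> (\<And>n :: nat. 0 < x n) \<Longrightarrow> x \<longlonglongrightarrow> u \<Longrightarrow> (\<lambda>n. F (x n)) \<longlonglongrightarrow> F u"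
    and ratio: "0 < v \<Longrightarrow> v < w \<Longrightarrow> 0 < F w \<Longrightarrow> v * F w < w * F v"
begin

lemma less_fixed:
  assumes "0 < p" "F p = p" "0 < v" "v < p"
  shows "v < F v"
  using ratio[of v p] assms by (simp add: mult.commute)

lemma greater_fixed:
  assumes "0 < p" "F p = p" "p < v"
  shows "F v < v"
proof -
  have "0 < F v" using mono[of p v] assms by simp
  then show ?thesis using ratio[of p v] assms by (simp add: mult.commute)
qed

lemma fixed_unique:
  assumes "0 < p" "F p = p" "0 < q" "F q = q"
  shows "p = q"
  using less_fixed[of p q] less_fixed[of q p] assms by (cases p q rule: linorder_cases) auto

text \<open>Intermediate value theorem for \<open>F x - x\<close>, which is nonnegative at
  \<open>v\<close> and nonpositive at \<open>max v c\<close> because \<open>F\<close> is bounded by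
  \<open>c\<close>.\<close>

lemma fixed_exists:
  assumes "0 < v" "v \<le> F v"
  obtains p where "0 < p" "F p = p"
proof -
  define b where "b = max v c"
  have "continuous_on {v..b} F"
    unfolding continuous_on_sequentially comp_def
    using assms(1) by (auto intro!: cont intro: less_le_trans)
  then have "continuous_on {v..b} (\<lambda>x. F x - x)" by (intro continuous_intros)
  moreover have "F b - b \<le> 0" using le[of b] by (auto simp: b_def)
  ultimately have "\<exists>x\<ge>v. x \<le> b \<and> F x - x = 0"
    using assms by (intro IVT2') (auto simp: b_def)
  then obtain x where "v \<le> x" "F x - x = 0" by blast
  then show ?thesis using that[of x] assms by simp
qed

lemma iterate_limit_fixed:
  assumes "(\<lambda>n. (F ^^ n) v) \<longlonglongrightarrow> L" "0 < L" "\<And>n. 0 < (F ^^ n) v"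
  shows "F L = L"
proof -
  have "(\<lambda>n. F ((F ^^ n) v)) \<longlonglongrightarrow> F L" by (intro cont assms)
  moreover have "(\<lambda>n. F ((F ^^ n) v)) \<longlonglongrightarrow> L" using LIMSEQ_Suc[OF assms(1)] by simp
  ultimately show ?thesis by (rule LIMSEQ_unique)
qed

text \<open>The orbit stays on its starting side of \<open>p\<close> and moves monotonically towards
  it. Its limit is a positive fixed point, hence \<open>p\<close>.\<close>

lemma iterate_tendsto_fixed:
  assumes p: "0 < p" "F p = p" and v: "0 < v"
  shows "(\<lambda>n. (F ^^ n) v) \<longlonglongrightarrow> p"
proof (cases "v \<le> p")
  case True
  have bd: "v \<le> (F ^^ n) v \<and> (F ^^ n) v \<le> p" and inc: "(F ^^ n) v \<le> F ((F ^^ n) v)" for n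
  proof -
    have step: "x \<le> F x" if "v \<le> x" "x \<le> p" for x
      using less_fixed[OF p, of x] p v that by (cases "x = p") auto
    show *: "v \<le> (F ^^ n) v \<and> (F ^^ n) v \<le> p" for n
    proof (induction n)
      case (Suc n)
      then have "v \<le> F ((F ^^ n) v)" using step[of "(F ^^ n) v"] by linarith
      moreover have "F ((F ^^ n) v) \<le> p" using mono[of "(F ^^ n) v" p] Suc v p by simp
      ultimately show ?case by simp
    qed (use True in simp)
    show "(F ^^ n) v \<le> F ((F ^^ n) v)" using step * by blast
  qed
  have "incseq (\<lambda>n. (F ^^ n) v)" using inc by (intro incseq_SucI) simp
  then obtain L where L: "(\<lambda>n. (F ^^ n) v) \<longlonglongrightarrow> L" "\<And>n. (F ^^ n) v \<le> L"
    using bd incseq_convergent[of "\<lambda>n. (F ^^ n) v" p] by blast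
  have "0 < L" using L(2)[of 0] v by simp
  then have "F L = L" using bd v by (intro iterate_limit_fixed[OF L(1)]) (auto intro: less_le_trans)
  then show ?thesis using fixed_unique[OF \<open>0 < L\<close> _ p] L(1) by simp
next
  case False
  have bd: "p \<le> (F ^^ n) v" and dec: "F ((F ^^ n) v) \<le> (F ^^ n) v" for n
  proof -
    show *: "p \<le> (F ^^ n) v" for n
    proof (induction n)
      case (Suc n)
      then show ?case using mono[of p "(F ^^ n) v"] p by simp
    qed (use False in simp)
    show "F ((F ^^ n) v) \<le> (F ^^ n) v"
      using greater_fixed[OF p, of "(F ^^ n) v"] p *[of n] by (cases "(F ^^ n) v = p") auto
  qed
  have "decseq (\<lambda>n. (F ^^ n) v)" using dec by (intro decseq_SucI) simp
  then obtain L where L: "(\<lambda>n. (F ^^ n) v) \<longlonglongrightarrow> L" "\<And>n. L \<le> (F ^^ n) v"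
    using bd decseq_convergent[of "\<lambda>n. (F ^^ n) v" p] by blast
  have "p \<le> L" using bd by (intro LIMSEQ_le_const[OF L(1)]) auto
  then have "0 < L" using p by simp
  then have "F L = L" using bd p by (intro iterate_limit_fixed[OF L(1)]) (auto intro: less_le_trans)
  then show ?thesis using fixed_unique[OF \<open>0 < L\<close> _ p] L(1) by simp
qed

text \<open>By \<open>fixed_exists\<close>, absence of a positive fixed point means
  \<open>F x < x\<close> for every positive \<open>x\<close>, so orbits decrease. A positive limit
  would be a fixed point.\<close>

lemma iterate_tendsto_0:
  assumes no: "\<And>p. 0 < p \<Longrightarrow> F p \<noteq> p" and v: "0 < v"
  shows "(\<lambda>n. (F ^^ n) v) \<longlonglongrightarrow> 0" "0 \<le> (F ^^ n) v"
proof -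
  have less: "F x < x" if "0 < x" for x
  proof (rule ccontr)
    assume "\<not> F x < x"
    then have "x \<le> F x" by simp
    from fixed_exists[OF that this] no show False by blast
  qed
  \<comment> \<open>Otherwise \<open>F (F 0) < F 0\<close>, against monotonicity.\<close>
  have "F 0 \<le> 0"
  proof (rule ccontr)
    assume "\<not> F 0 \<le> 0"
    then show False using less[of "F 0"] mono[of 0 "F 0"] by simp
  qed
  then have dec: "F x \<le> x" if "0 \<le> x" for x
    using that less[of x] by (cases "x = 0") auto
  show nn: "0 \<le> (F ^^ n) v" for n
    using v nonneg by (cases n) auto
  have "decseq (\<lambda>n. (F ^^ n) v)" using dec nn by (intro decseq_SucI) simp
  then obtain L where L: "(\<lambda>n. (F ^^ n) v) \<longlonglongrightarrow> L" "\<And>n. L \<le> (F ^^ n) v"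
    using nn decseq_convergent[of "\<lambda>n. (F ^^ n) v" 0] by blast
  have "0 \<le> L" using nn by (intro LIMSEQ_le_const[OF L(1)]) auto
  moreover have "\<not> 0 < L"
  proof
    assume "0 < L"
    then have "F L = L" using L(2) by (intro iterate_limit_fixed[OF L(1)]) (auto intro: less_le_trans)
    then show False using no \<open>0 < L\<close> by blast
  qed
  ultimately show "(\<lambda>n. (F ^^ n) v) \<longlonglongrightarrow> 0" using L(1) by simp
qed

end

section \<open>Behaviour for small signal\<close>

lemma nn_integral_gauss_square: "(\<integral>\<^sup>+z. ennreal (z\<^sup>2) \<partial>std_gauss) = 1"
proof -
  have "has_bochner_integral lborel (\<lambda>x. std_normal_density x * x\<^sup>2) 1"
    using std_normal_moment_even[of 1] by (simp add: fact_2)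
  then have "(\<integral>\<^sup>+z. ennreal (std_normal_density z * z\<^sup>2) \<partial>lborel) = ennreal 1"
    by (intro nn_integral_eq_integral[THEN trans]) (auto simp: has_bochner_integral_iff)
  then show ?thesis by (simp add: nn_integral_std_gauss ennreal_mult)
qed

text \<open>This is the derivative of \<open>tanh\<close> at \<open>0\<close>. Filling in the
  removable singularity allows composition with sequences that hit \<open>0\<close>.\<close>

lemma tanh_over_tendsto: "((\<lambda>x::real. if x = 0 then 1 else tanh x / x) \<longlongrightarrow> 1) (nhds 0)"
proof -
  have "(tanh has_real_derivative 1 - (tanh 0)\<^sup>2) (at (0::real))"
    using has_field_derivative_tanh[OF _ DERIV_ident, of "0::real"] by simp
  then have "((\<lambda>x::real. tanh x / x) \<longlongrightarrow> 1) (at 0)"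
    by (simp add: has_field_derivative_iff)
  then have "((\<lambda>x::real. if x = 0 then 1 else tanh x / x) \<longlongrightarrow> 1) (at 0)"
    by (rule Lim_transform_eventually) (auto simp: eventually_at_filter)
  then show ?thesis
    by (subst tendsto_at_iff_tendsto_nhds[symmetric, of "\<lambda>x::real. if x = 0 then 1 else tanh x / x" 0, simplified]) simp
qed

text \<open>Near \<open>0\<close>, \<open>info r\<close> behaves like \<open>r\<^sup>2\<close>. At
  signal \<open>D / (n + 1)\<close> the fluctuation has order \<open>1 / sqrt (n + 1)\<close>, while
  the drift is of lower order and disappears after scaling.\<close>

lemma scaled_info_tendsto:
  assumes "0 \<le> D"
  shows "(\<lambda>n. real (Suc n) * info (gauss_map (ennreal D * ennreal (1 / real (Suc n))) z)) \<longlonglongrightarrow> D * z\<^sup>2"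
proof -
  define q where "q = (\<lambda>x::real. if x = 0 then 1 else tanh x / x)"
  define x where "x n = (D * (1 / real (Suc n)) / 2 + sqrt (D * (1 / real (Suc n))) * z) / 2" for n
  have N: "(\<lambda>n. 1 / real (Suc n)) \<longlonglongrightarrow> 0" using LIMSEQ_inverse_real_of_nat by (simp add: inverse_eq_divide)
  have sqN: "(\<lambda>n. sqrt (1 / real (Suc n))) \<longlonglongrightarrow> 0" using tendsto_real_sqrt[OF N] by simp
  have "x \<longlonglongrightarrow> (D * 0 / 2 + sqrt (D * 0) * z) / 2"
    unfolding x_def by (intro tendsto_intros N) auto
  then have q: "(\<lambda>n. q (x n)) \<longlonglongrightarrow> 1"
    using filterlim_compose[OF tanh_over_tendsto] by (simp add: q_def)
  have tanh_q: "tanh y = y * q y" for y by (simp add: q_def)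
  have y: "sqrt (real (Suc n)) * (2 * x n) = D / 2 * sqrt (1 / real (Suc n)) + sqrt D * z" for n
  proof -
    define a where "a = sqrt (1 / real (Suc n))"
    have "1 / real (Suc n) = a * a" by (simp add: a_def)
    then have "2 * x n = a * (D / 2 * a + sqrt D * z)"
      unfolding x_def real_sqrt_mult a_def[symmetric] by (simp add: algebra_simps)
    moreover have "sqrt (real (Suc n)) * a = 1"
      by (simp add: a_def real_sqrt_mult[symmetric] del: of_nat_Suc)
    ultimately show ?thesis by (simp add: a_def[symmetric] mult.assoc[symmetric] del: of_nat_Suc)
  qed
  have "real (Suc n) * info (gauss_map (ennreal D * ennreal (1 / real (Suc n))) z)
      = (D / 2 * sqrt (1 / real (Suc n)) + sqrt D * z)\<^sup>2 * (q (x n))\<^sup>2" for n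
  proof -
    have "gauss_map (ennreal D * ennreal (1 / real (Suc n))) z = ereal (2 * x n)"
      using assms by (simp add: gauss_map_def x_def flip: ennreal_mult)
    then have "real (Suc n) * info (gauss_map (ennreal D * ennreal (1 / real (Suc n))) z)
       = (sqrt (real (Suc n)) * (2 * x n))\<^sup>2 * (q (x n))\<^sup>2"
      by (simp add: tanh_q[of "x n"] power_mult_distrib)
    then show ?thesis unfolding y .
  qed
  moreover have "(\<lambda>n. (D / 2 * sqrt (1 / real (Suc n)) + sqrt D * z)\<^sup>2 * (q (x n))\<^sup>2)
      \<longlonglongrightarrow> (D / 2 * 0 + sqrt D * z)\<^sup>2 * 1\<^sup>2"
    by (intro tendsto_intros sqN q)
  ultimately show ?thesis using assms by (simp add: power_mult_distrib)
qed

section \<open>Continuity of the output law and the real scalar map\<close>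

context large_degree_bp
begin

text \<open>Dominated convergence on the common product space. Where \<open>d = \<infinity>\<close>,
  \<open>bp_var v\<close> is \<open>\<infinity>\<close> for \<open>v > 0\<close> but
  \<open>r\<close> at \<open>v = 0\<close>; the assumption \<open>pos\<close> excludes this jump. At
  infinite \<open>r\<close> or \<open>d\<close> the variable does not move along the sequence, so
  continuity of \<open>f\<close> at real points suffices.\<close>

lemma tendsto_integral_bp_map:
  fixes f :: "ereal \<Rightarrow> real" and v :: "nat \<Rightarrow> real"
  assumes f [measurable]: "f \<in> borel_measurable borel" and bd: "\<And>x. \<bar>f x\<bar> \<le> B"
    and cont: "continuous_on UNIV (\<lambda>x. f (ereal x))"
    and v: "v \<longlonglongrightarrow> u" "\<And>n. 0 \<le> v n" "0 \<le> u"
    and pos: "(AE d in P. d \<noteq> \<infinity>) \<or> (0 < u \<and> (\<forall>n. 0 < v n))"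
  shows "(\<lambda>n. \<integral>x. f x \<partial>bp_map (ennreal (v n))) \<longlonglongrightarrow> (\<integral>x. f x \<partial>bp_map (ennreal u))"
proof -
  let ?M = "\<mu>s \<Otimes>\<^sub>M (P \<Otimes>\<^sub>M std_gauss)"
  have int: "(\<integral>x. f x \<partial>bp_map w) = (\<integral>\<omega>. f (bp_var w \<omega>) \<partial>?M)" for w
    unfolding bp_map_def by (rule integral_distr) auto
  show ?thesis
    unfolding int
  proof (rule integral_dominated_convergence[where w = "\<lambda>_. B"])
    let ?Q = "\<lambda>\<omega>. fst \<omega> \<noteq> -\<infinity> \<and> (fst (snd \<omega>) \<noteq> \<infinity> \<or> 0 < u \<and> (\<forall>n. 0 < v n))"
    have "AE \<omega> in ?M. ?Q \<omega>"
    proof (rule SPG.AE_pair_measure)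
      have "AE d in P. d \<noteq> \<infinity> \<or> 0 < u \<and> (\<forall>n. 0 < v n)"
        using pos
      proof
        assume "AE d in P. d \<noteq> \<infinity>"
        then show ?thesis by eventually_elim simp
      qed simp
      then have "AE p in P \<Otimes>\<^sub>M std_gauss. fst p \<noteq> \<infinity> \<or> 0 < u \<and> (\<forall>n. 0 < v n)"
      proof (intro PG.AE_pair_measure)
        assume "AE d in P. d \<noteq> \<infinity> \<or> 0 < u \<and> (\<forall>n. 0 < v n)"
        then show "AE d in P. AE z in std_gauss. fst (d, z) \<noteq> \<infinity> \<or> 0 < u \<and> (\<forall>n. 0 < v n)"
          by eventually_elim simp
      qed measurable
      then have *: "AE p in P \<Otimes>\<^sub>M std_gauss. ?Q (r, p)" if "r \<noteq> -\<infinity>" for r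
        by eventually_elim (use that in simp)
      show "AE r in \<mu>s. AE p in P \<Otimes>\<^sub>M std_gauss. ?Q (r, p)"
        using AE_s by eventually_elim (rule *)
    qed measurable
    then show "AE \<omega> in ?M. (\<lambda>n. f (bp_var (ennreal (v n)) \<omega>)) \<longlonglongrightarrow> f (bp_var (ennreal u) \<omega>)"
    proof eventually_elim
      case (elim \<omega>)
      obtain r d z where \<omega>: "\<omega> = (r, d, z)" by (metis prod_cases3)
      show ?case
      proof (cases r)
        case (real x)
        show ?thesis
        proof (cases d)
          case (real D)
          have eq: "bp_var (ennreal w) \<omega> = ereal (D * w / 2 + sqrt (D * w) * z + x)" if "0 \<le> w" for w
            using that real \<open>r = ereal x\<close> by (simp add: bp_var_def \<omega> gauss_map_def flip: ennreal_mult)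
          have "(\<lambda>n. D * v n / 2 + sqrt (D * v n) * z + x) \<longlonglongrightarrow> D * u / 2 + sqrt (D * u) * z + x"
            by (intro tendsto_intros v) auto
          moreover have "isCont (\<lambda>x. f (ereal x)) y" for y
            using cont by (simp add: continuous_on_eq_continuous_at)
          ultimately show ?thesis
            unfolding eq[OF v(2)] eq[OF v(3)] by (rule isCont_tendsto_compose[rotated])
        next
          case top
          have "bp_var (ennreal w) \<omega> = \<infinity>" if "0 < w" for w
            using that top by (simp add: \<omega> bp_var_def ennreal_top_mult)
          then show ?thesis using elim top by (simp add: \<omega>)
        qed
      qed (use elim in \<open>simp_all add: \<omega> bp_var_def\<close>)
    qed
    show "integrable ?M (\<lambda>_. B)" by simp
  qed (use bd in auto)
qed

lemma weak_conv_bp_map: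
  fixes v :: "nat \<Rightarrow> real"
  assumes v: "v \<longlonglongrightarrow> u" "\<And>n. 0 \<le> v n" "0 \<le> u"
    and pos: "(AE d in P. d \<noteq> \<infinity>) \<or> (0 < u \<and> (\<forall>n. 0 < v n))"
  shows "weak_conv_llr (\<lambda>n. bp_map (ennreal (v n))) (bp_map (ennreal u))"
  unfolding weak_conv_llr_def set_lebesgue_integral_def
proof (intro allI impI)
  fix f :: "ereal \<Rightarrow> real"
  assume cont: "continuous_on {-\<infinity><..} f" and "bounded (f ` {-\<infinity><..})"
  then obtain B where B: "\<And>x. x \<in> {-\<infinity><..} \<Longrightarrow> norm (f x) \<le> B"
    unfolding bounded_iff by blast
  show "(\<lambda>n. \<integral>x. indicator {-\<infinity><..} x *\<^sub>R f x \<partial>bp_map (ennreal (v n)))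
    \<longlonglongrightarrow> (\<integral>x. indicator {-\<infinity><..} x *\<^sub>R f x \<partial>bp_map (ennreal u))"
  proof (rule tendsto_integral_bp_map[OF _ _ _ v pos])
    show "(\<lambda>x. indicator {-\<infinity><..} x *\<^sub>R f x) \<in> borel_measurable borel"
      by (rule borel_measurable_continuous_on_indicator) (use cont in auto)
    show "\<bar>indicator {-\<infinity><..} x *\<^sub>R f x\<bar> \<le> \<bar>B\<bar>" for x
      using B[of x] by (auto simp: indicator_def)
    have "continuous_on UNIV (\<lambda>x. f (ereal x))"
      by (rule continuous_on_compose2[OF cont]) (auto intro: continuous_on_ereal)
    then show "continuous_on UNIV (\<lambda>x. indicator {-\<infinity><..} (ereal x) *\<^sub>R f (ereal x))"
      by simp
  qed
qed

definition real_map :: "real \<Rightarrow> real" where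
  "real_map v = enn2real (V_map (ennreal v))"

lemma V_map_neq_top: "V_map v \<noteq> top"
  using V_map_le[of v] by (auto simp: top_unique)

lemma ennreal_real_map: "ennreal (real_map v) = V_map (ennreal v)"
  unfolding real_map_def using V_map_neq_top by (simp add: less_top)

lemma real_map_eq_integral: "real_map v = (\<integral>x. info x \<partial>bp_map (ennreal v))"
  unfolding real_map_def V_map_def V_of_symmetric[OF symmetric_bp_map]
  by (rule integral_eq_nn_integral[symmetric]) auto

sublocale sublinear_map real_map 4
proof
  show "real_map v \<le> real_map w" if "0 \<le> v" "v \<le> w" for v w
    unfolding real_map_def using that V_map_neq_top
    by (intro enn2real_mono V_map_mono) (auto simp: less_top ennreal_leI)
  show "0 \<le> real_map v" for v by (simp add: real_map_def)
  show "real_map v \<le> 4" for v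
    unfolding real_map_def by (rule enn2real_leI) (use V_map_le in auto)
  show "(\<lambda>n. real_map (x n)) \<longlonglongrightarrow> real_map u"
    if "0 < u" "\<And>n. 0 < x n" "x \<longlonglongrightarrow> u" for u and x :: "nat \<Rightarrow> real"
    unfolding real_map_eq_integral
  proof (rule tendsto_integral_bp_map[where B = 4])
    show "continuous_on UNIV (\<lambda>x. info (ereal x))"
      by (simp, intro continuous_intros) auto
  qed (use that in \<open>auto intro: less_imp_le\<close>)
  show "v * real_map w < w * real_map v" if "0 < v" "v < w" "0 < real_map w" for v w
  proof -
    have nn: "0 \<le> real_map x" for x by (simp add: real_map_def)
    have "ennreal v * V_map (ennreal w) < ennreal w * V_map (ennreal v)"
      using that by (intro V_map_ratio) (auto simp: ennreal_real_map[symmetric])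
    then show ?thesis
      using that nn by (simp add: ennreal_real_map[symmetric] ennreal_less_iff flip: ennreal_mult)
  qed
qed

section \<open>Fixed points and the threshold\<close>

lemma V_map_0: "V_map 0 = V_of \<mu>s"
proof -
  have "gauss_info 0 r = info r" for r by (simp add: gauss_info_def)
  then show ?thesis
    by (simp add: V_map_eq V_of_symmetric[OF symmetric_s] P.emeasure_space_1[simplified])
qed

lemma V_map_trivial:
  assumes "\<mu>s = trivial_dist"
  shows "V_map v = (\<integral>\<^sup>+d. gauss_info (d * v) 0 \<partial>P)"
proof -
  have "(\<integral>\<^sup>+r. k r \<partial>\<mu>s) = k 0" if "k \<in> borel_measurable borel" for k
    using nn_integral_return[of 0 borel k] that by (simp add: assms trivial_dist_def)
  then show ?thesis unfolding V_map_eq by simp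
qed

text \<open>\<open>V_of\<close> and \<open>bp_map\<close> are mutually inverse between the
  non-trivial fixed points and the positive fixed points of \<open>real_map\<close>; positivity
  corresponds to non-triviality through \<open>V_of_eq_0_iff\<close>.\<close>

lemma nontrivial_fixed_point_iff:
  "BP_fixed_point P \<mu>s \<mu> \<and> \<mu> \<noteq> trivial_dist \<longleftrightarrow> (\<exists>v>0. real_map v = v \<and> \<mu> = bp_map (ennreal v))"
proof
  assume \<mu>: "BP_fixed_point P \<mu>s \<mu> \<and> \<mu> \<noteq> trivial_dist"
  then have LLR: "LLR_dist \<mu>" and fp: "bp_map (V_of \<mu>) = \<mu>"
    by (auto simp: BP_fixed_point_def Q_L_eq_bp_map)
  have "V_of \<mu> \<noteq> 0" "V_of \<mu> \<noteq> top"
    using V_of_eq_0_iff[OF LLR] \<mu> V_of_le[OF LLR] by (auto simp: top_unique)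
  then have "0 < enn2real (V_of \<mu>)" "ennreal (enn2real (V_of \<mu>)) = V_of \<mu>"
    by (auto simp: enn2real_positive_iff less_top zero_less_iff_neq_zero)
  then show "\<exists>v>0. real_map v = v \<and> \<mu> = bp_map (ennreal v)"
    by (intro exI[of _ "enn2real (V_of \<mu>)"]) (simp add: real_map_def V_map_def fp)
next
  assume "\<exists>v>0. real_map v = v \<and> \<mu> = bp_map (ennreal v)"
  then obtain v where v: "0 < v" "real_map v = v" "\<mu> = bp_map (ennreal v)" by blast
  have V: "V_of \<mu> = ennreal v"
    using ennreal_real_map[of v] v by (simp add: V_map_def)
  moreover have "LLR_dist \<mu>" using v LLR_bp_map by simp
  ultimately show "BP_fixed_point P \<mu>s \<mu> \<and> \<mu> \<noteq> trivial_dist"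
    using V_of_eq_0_iff[of \<mu>] v by (auto simp: BP_fixed_point_def Q_L_eq_bp_map)
qed

text \<open>Integrating \<open>gauss_info s 0 < s\<close> at \<open>s = d * v\<close> gives
  \<open>v < E[d] * v\<close>. It remains strict because \<open>d = 0\<close> almost surely would
  make the left side \<open>0\<close>.\<close>

lemma trivial_imp_mean_gt_1:
  assumes triv: "\<mu>s = trivial_dist" and v: "0 < v" "real_map v = v"
  shows "1 < (\<integral>\<^sup>+d. d \<partial>P)"
proof -
  have V: "ennreal v = (\<integral>\<^sup>+d. gauss_info (d * ennreal v) 0 \<partial>P)"
    using ennreal_real_map[of v] v V_map_trivial[OF triv] by simp
  have lt: "gauss_info (d * ennreal v) 0 < d * ennreal v" if "d \<noteq> 0" for d
    using v that by (intro gauss_info_0_less) auto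
  have "(\<integral>\<^sup>+d. gauss_info (d * ennreal v) 0 \<partial>P) < (\<integral>\<^sup>+d. d * ennreal v \<partial>P)"
  proof (rule nn_integral_less)
    show "(\<integral>\<^sup>+d. gauss_info (d * ennreal v) 0 \<partial>P) \<noteq> \<infinity>" unfolding V[symmetric] by simp
    have "gauss_info 0 0 = 0" by (simp add: gauss_info_def)
    then have le: "gauss_info (d * ennreal v) 0 \<le> d * ennreal v" for d
      using lt[of d] by (cases "d = 0") auto
    then show "AE d in P. gauss_info (d * ennreal v) 0 \<le> d * ennreal v" by simp
    show "\<not> (AE d in P. d * ennreal v \<le> gauss_info (d * ennreal v) 0)"
    proof
      assume "AE d in P. d * ennreal v \<le> gauss_info (d * ennreal v) 0"
      then have "AE d in P. gauss_info (d * ennreal v) 0 = 0"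
      proof eventually_elim
        case (elim d)
        then have "d = 0" using lt[of d] by (auto simp: not_le[symmetric])
        then show ?case using \<open>gauss_info 0 0 = 0\<close> by simp
      qed
      then have "(\<integral>\<^sup>+d. gauss_info (d * ennreal v) 0 \<partial>P) = 0"
        by (subst nn_integral_0_iff_AE) auto
      then show False using V v by simp
    qed
  qed auto
  then have less: "ennreal v < (\<integral>\<^sup>+d. d \<partial>P) * ennreal v"
    unfolding V[symmetric] by (simp add: nn_integral_multc)
  show ?thesis
  proof (rule ccontr)
    assume "\<not> 1 < (\<integral>\<^sup>+d. d \<partial>P)"
    then have "(\<integral>\<^sup>+d. d \<partial>P) * ennreal v \<le> 1 * ennreal v" by (intro mult_right_mono) auto
    with less show False by (simp add: not_le[symmetric])
  qed
qed

text \<open>The value \<open>F(0)\<close> is \<open>V_of \<mu>s > 0\<close>, and by monotonicity it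
  lies below its own image, so \<open>fixed_exists\<close> applies there.\<close>

lemma fixed_exists_nontrivial:
  assumes "\<mu>s \<noteq> trivial_dist"
  obtains p where "0 < p" "real_map p = p"
proof -
  have "V_map 0 \<noteq> 0"
    unfolding V_map_0 using V_of_eq_0_iff[OF symmetric_imp_LLR_dist[OF symmetric_s]] assms by simp
  then have "0 < real_map 0"
    using V_map_neq_top by (simp add: real_map_def enn2real_positive_iff less_top zero_less_iff_neq_zero)
  moreover have "real_map 0 \<le> real_map (real_map 0)"
    using \<open>0 < real_map 0\<close> by (intro mono) auto
  ultimately show ?thesis by (rule fixed_exists) (rule that)
qed

text \<open>Fatou's lemma over \<open>z\<close> and over \<open>d\<close> along
  \<open>v = 1 / (n + 1)\<close>: the scaled integrands tend to at least
  \<open>d * z\<^sup>2\<close>, and \<open>E[z\<^sup>2] = 1\<close>. Hence \<open>F(v) / v\<close>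
  eventually exceeds \<open>1\<close>, and \<open>fixed_exists\<close> applies to such a
  \<open>v\<close>.\<close>

lemma fixed_exists_mean_gt_1:
  assumes triv: "\<mu>s = trivial_dist" and mean: "1 < (\<integral>\<^sup>+d. d \<partial>P)"
  obtains p where "0 < p" "real_map p = p"
proof -
  define w where "w n = 1 / real (Suc n)" for n
  define h where "h n d z = ennreal (real (Suc n)) * ennreal (info (gauss_map (d * ennreal (w n)) z))" for n d z
  have [measurable]: "case_prod (h n) \<in> borel_measurable (P \<Otimes>\<^sub>M std_gauss)" for n
    unfolding h_def by measurable
  have [measurable]: "h n d \<in> borel_measurable std_gauss" for n d
    unfolding h_def by measurable
  have lim: "d * ennreal (z\<^sup>2) \<le> liminf (\<lambda>n. h n d z)" for d z
  proof (cases d)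
    case (real D)
    have "(\<lambda>n. ennreal (real (Suc n) * info (gauss_map (ennreal D * ennreal (1 / real (Suc n))) z)))
        \<longlonglongrightarrow> ennreal (D * z\<^sup>2)"
      by (intro tendsto_ennrealI scaled_info_tendsto real)
    then have "(\<lambda>n. h n d z) \<longlonglongrightarrow> d * ennreal (z\<^sup>2)"
      using real by (simp add: h_def w_def ennreal_mult del: of_nat_Suc)
    then show ?thesis by (simp add: lim_imp_Liminf)
  next
    case top
    have "filterlim (\<lambda>n. ennreal (real (Suc n)) * 4) (nhds top) sequentially"
    proof -
      have "filterlim (\<lambda>n. 4 * real (Suc n)) at_top sequentially"
        by (intro filterlim_tendsto_pos_mult_at_top[OF tendsto_const] filterlim_compose[OF filterlim_real_sequentially filterlim_Suc]) auto
      then have "(\<lambda>n. ennreal (4 * real (Suc n))) \<longlonglongrightarrow> top"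
        unfolding ennreal_tendsto_top_eq_at_top .
      then show ?thesis by (simp add: ennreal_mult mult.commute del: of_nat_Suc)
    qed
    then have "(\<lambda>n. h n d z) \<longlonglongrightarrow> top"
      using top by (simp add: h_def w_def ennreal_top_mult del: of_nat_Suc)
    then show ?thesis by (simp add: lim_imp_Liminf)
  qed
  have "(\<integral>\<^sup>+d. d \<partial>P) = (\<integral>\<^sup>+d. \<integral>\<^sup>+z. d * ennreal (z\<^sup>2) \<partial>std_gauss \<partial>P)"
    by (simp add: nn_integral_cmult nn_integral_gauss_square)
  also have "\<dots> \<le> (\<integral>\<^sup>+d. \<integral>\<^sup>+z. liminf (\<lambda>n. h n d z) \<partial>std_gauss \<partial>P)"
    by (intro nn_integral_mono lim)
  also have "\<dots> \<le> (\<integral>\<^sup>+d. liminf (\<lambda>n. \<integral>\<^sup>+z. h n d z \<partial>std_gauss) \<partial>P)"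
    by (intro nn_integral_mono nn_integral_liminf) simp
  also have "\<dots> \<le> liminf (\<lambda>n. \<integral>\<^sup>+d. \<integral>\<^sup>+z. h n d z \<partial>std_gauss \<partial>P)"
    by (rule nn_integral_liminf) simp
  finally have "1 < liminf (\<lambda>n. \<integral>\<^sup>+d. \<integral>\<^sup>+z. h n d z \<partial>std_gauss \<partial>P)"
    using mean by (rule less_le_trans[rotated])
  moreover have "(\<integral>\<^sup>+d. \<integral>\<^sup>+z. h n d z \<partial>std_gauss \<partial>P) = ennreal (real (Suc n)) * V_map (ennreal (w n))" for n
    unfolding h_def V_map_trivial[OF triv] gauss_info_def
    by (simp add: nn_integral_cmult del: of_nat_Suc)
  ultimately have "1 < liminf (\<lambda>n. ennreal (real (Suc n)) * V_map (ennreal (w n)))"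
    by (simp only:)
  then have "\<forall>\<^sub>F n in sequentially. 1 < ennreal (real (Suc n)) * V_map (ennreal (w n))"
    by (rule less_LiminfD)
  then obtain n where "1 < ennreal (real (Suc n)) * V_map (ennreal (w n))"
    using eventually_happens'[OF sequentially_bot] by blast
  then have "1 < ennreal (real (Suc n) * real_map (w n))"
    unfolding ennreal_real_map[symmetric] by (simp add: ennreal_mult nonneg del: of_nat_Suc)
  then have "1 < real (Suc n) * real_map (w n)" 
    by (metis ennreal_1 ennreal_less_iff zero_le_one)
  then have "w n \<le> real_map (w n)" "0 < w n"
    by (auto simp: w_def field_simps)
  from fixed_exists[OF this(2,1)] show ?thesis using that by blast
qed

lemma fixed_exists_iff: "(\<exists>p>0. real_map p = p) \<longleftrightarrow> 1 < (\<integral>\<^sup>+d. d \<partial>P) \<or> \<mu>s \<noteq> trivial_dist"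
  using trivial_imp_mean_gt_1 fixed_exists_nontrivial fixed_exists_mean_gt_1 by metis

section \<open>Convergence of the iterates\<close>

text \<open>The first application only turns \<open>\<mu>\<close> into
  \<open>bp_map (V_of \<mu>)\<close>, so the scalar orbit lags one step behind.\<close>

lemma Q_L_iterate:
  assumes "V_of \<mu> \<noteq> top"
  shows "(Q_L P \<mu>s ^^ Suc h) \<mu> = bp_map (ennreal ((real_map ^^ h) (enn2real (V_of \<mu>))))"
proof (induction h)
  case 0
  then show ?case using assms by (simp add: Q_L_eq_bp_map less_top)
next
  case (Suc h)
  have "(Q_L P \<mu>s ^^ Suc (Suc h)) \<mu> = Q_L P \<mu>s (bp_map (ennreal ((real_map ^^ h) (enn2real (V_of \<mu>)))))"
    unfolding Suc.IH[symmetric] by simp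
  also have "\<dots> = bp_map (V_map (ennreal ((real_map ^^ h) (enn2real (V_of \<mu>)))))"
    by (simp only: Q_L_eq_bp_map V_map_def)
  finally show ?case by (simp add: ennreal_real_map)
qed

lemma weak_conv_llr_Suc: "weak_conv_llr (\<lambda>n. M (Suc n)) N \<Longrightarrow> weak_conv_llr M N"
  unfolding weak_conv_llr_def
  by (auto simp: filterlim_sequentially_Suc[of "\<lambda>n. LINT x:A|M n. f x" for A f])

lemma weak_conv_fixed:
  assumes \<mu>: "LLR_dist \<mu>" "\<mu> \<noteq> trivial_dist" and \<nu>: "BP_fixed_point P \<mu>s \<nu>" "\<nu> \<noteq> trivial_dist"
  shows "weak_conv_llr (\<lambda>h. (Q_L P \<mu>s ^^ h) \<mu>) \<nu>"
proof -
  obtain p where p: "0 < p" "real_map p = p" "\<nu> = bp_map (ennreal p)"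
    using \<nu> nontrivial_fixed_point_iff by blast
  have V: "V_of \<mu> \<noteq> 0" "V_of \<mu> \<noteq> top"
    using V_of_eq_0_iff \<mu> V_of_le[OF \<mu>(1)] by (auto simp: top_unique)
  define v where "v = enn2real (V_of \<mu>)"
  have v: "0 < v" using V by (auto simp: v_def enn2real_positive_iff less_top zero_less_iff_neq_zero)
  \<comment> \<open>Positivity keeps the orbit away from the possible jump at \<open>0\<close>. The
    image of \<open>x\<close> is at least the image of \<open>min x p\<close>, which is at least
    \<open>min x p\<close> itself.\<close>
  have pos: "0 < (real_map ^^ n) v" for n
  proof (induction n)
    case (Suc n)
    have "0 < min ((real_map ^^ n) v) p" using Suc p by simp
    moreover have "real_map (min ((real_map ^^ n) v) p) \<le> real_map ((real_map ^^ n) v)"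
      using Suc p by (intro mono) auto
    moreover have "min ((real_map ^^ n) v) p \<le> real_map (min ((real_map ^^ n) v) p)"
      using less_fixed[OF p(1,2), of "(real_map ^^ n) v"] Suc p by (cases "(real_map ^^ n) v < p") (auto simp: min_def)
    ultimately have "0 < real_map ((real_map ^^ n) v)" by linarith
    then show ?case by simp
  qed (simp add: v)
  show ?thesis
    unfolding p(3)
  proof (rule weak_conv_llr_Suc, unfold Q_L_iterate[OF V(2)] v_def[symmetric], rule weak_conv_bp_map)
    show "(\<lambda>n. (real_map ^^ n) v) \<longlonglongrightarrow> p" by (rule iterate_tendsto_fixed[OF p(1,2) v])
  qed (use pos p in \<open>auto intro: less_imp_le\<close>)
qed

text \<open>By \<open>fixed_exists_iff\<close>, \<open>\<mu>s\<close> is trivial and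
  \<open>E[d] <= 1\<close>. Hence \<open>d\<close> is almost surely finite, the output law is
  continuous at \<open>0\<close>, and its value there is the trivial distribution.\<close>

lemma weak_conv_trivial:
  assumes \<mu>: "LLR_dist \<mu>" "\<mu> \<noteq> trivial_dist" and no: "\<nexists>\<nu>. BP_fixed_point P \<mu>s \<nu> \<and> \<nu> \<noteq> trivial_dist"
  shows "weak_conv_llr (\<lambda>h. (Q_L P \<mu>s ^^ h) \<mu>) trivial_dist"
proof -
  have no: "real_map p \<noteq> p" if "0 < p" for p
    using no that nontrivial_fixed_point_iff by blast
  then have triv: "\<mu>s = trivial_dist" and mean: "(\<integral>\<^sup>+d. d \<partial>P) \<le> 1"
    using fixed_exists_iff by (auto simp: not_less)
  have V: "V_of \<mu> \<noteq> 0" "V_of \<mu> \<noteq> top"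
    using V_of_eq_0_iff \<mu> V_of_le[OF \<mu>(1)] by (auto simp: top_unique)
  define v where "v = enn2real (V_of \<mu>)"
  have v: "0 < v" using V by (auto simp: v_def enn2real_positive_iff less_top zero_less_iff_neq_zero)
  have "V_of \<mu>s = 0"
    using V_of_eq_0_iff[OF symmetric_imp_LLR_dist[OF symmetric_s]] triv by blast
  then have "V_of (bp_map 0) = 0" using V_map_0 by (simp add: V_map_def)
  then have bp0: "bp_map (ennreal 0) = trivial_dist"
    using V_of_eq_0_iff[OF LLR_bp_map] by simp
  have fin: "AE d in P. d \<noteq> \<infinity>"
    using mean by (intro nn_integral_PInf_AE) (auto simp: top_unique)
  show ?thesis
    unfolding bp0[symmetric]
  proof (rule weak_conv_llr_Suc, unfold Q_L_iterate[OF V(2)] v_def[symmetric], rule weak_conv_bp_map)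
    show "(\<lambda>n. (real_map ^^ n) v) \<longlonglongrightarrow> 0" "0 \<le> (real_map ^^ n) v" for n
      using iterate_tendsto_0[OF no v] by auto
  qed (use fin in auto)
qed

text \<open>One application of the operator gives \<open>bp_map 0\<close>, which is non-trivial
  because its \<open>V_of\<close> equals that of \<open>\<mu>s\<close>; from there
  \<open>weak_conv_fixed\<close> applies.\<close>

lemma weak_conv_from_trivial:
  assumes s: "\<mu>s \<noteq> trivial_dist" and \<nu>: "BP_fixed_point P \<mu>s \<nu>" "\<nu> \<noteq> trivial_dist"
  shows "weak_conv_llr (\<lambda>h. (Q_L P \<mu>s ^^ h) trivial_dist) \<nu>"
proof (rule weak_conv_llr_Suc)
  have triv: "V_of trivial_dist = 0"
    using V_of_eq_0_iff[OF symmetric_imp_LLR_dist[OF symmetric_trivial_dist]] by simp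
  have "V_of (bp_map 0) \<noteq> 0"
    using V_map_0 V_of_eq_0_iff[OF symmetric_imp_LLR_dist[OF symmetric_s]] s by (simp add: V_map_def)
  then have "Q_L P \<mu>s trivial_dist \<noteq> trivial_dist" "LLR_dist (Q_L P \<mu>s trivial_dist)"
    using triv LLR_bp_map by (auto simp: Q_L_eq_bp_map)
  then have "weak_conv_llr (\<lambda>h. (Q_L P \<mu>s ^^ h) (Q_L P \<mu>s trivial_dist)) \<nu>"
    using \<nu> by (intro weak_conv_fixed)
  then show "weak_conv_llr (\<lambda>h. (Q_L P \<mu>s ^^ Suc h) trivial_dist) \<nu>"
    by (simp only: funpow_Suc_right comp_def)
qed

text \<open>A fixed point is an output of the operator, and every output is symmetric.\<close>

lemma symmetric_fixed_point:
  assumes "BP_fixed_point P \<mu>s \<mu>"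
  shows "symmetric_dist \<mu>"
  using assms symmetric_bp_map by (metis BP_fixed_point_def Q_L_eq_bp_map)

lemma nontrivial_fixed_point_exists_iff:
  "(\<exists>\<mu>. BP_fixed_point P \<mu>s \<mu> \<and> symmetric_dist \<mu> \<and> \<mu> \<noteq> trivial_dist)
    \<longleftrightarrow> 1 < (\<integral>\<^sup>+d. d \<partial>P) \<or> \<mu>s \<noteq> trivial_dist"
proof -
  have "(\<exists>\<mu>. BP_fixed_point P \<mu>s \<mu> \<and> symmetric_dist \<mu> \<and> \<mu> \<noteq> trivial_dist)
      \<longleftrightarrow> (\<exists>\<mu>. BP_fixed_point P \<mu>s \<mu> \<and> \<mu> \<noteq> trivial_dist)"
    using symmetric_fixed_point by blast
  then show ?thesis
    unfolding fixed_exists_iff[symmetric] nontrivial_fixed_point_iff by blast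
qed

lemma nontrivial_fixed_point_unique:
  assumes "BP_fixed_point P \<mu>s \<mu>" "\<mu> \<noteq> trivial_dist" "BP_fixed_point P \<mu>s \<nu>" "\<nu> \<noteq> trivial_dist"
  shows "\<mu> = \<nu>"
proof -
  obtain p where p: "0 < p" "real_map p = p" "\<mu> = bp_map (ennreal p)"
    using nontrivial_fixed_point_iff assms(1,2) by blast
  obtain q where q: "0 < q" "real_map q = q" "\<nu> = bp_map (ennreal q)"
    using nontrivial_fixed_point_iff assms(3,4) by blast
  show ?thesis using fixed_unique[OF p(1,2) q(1,2)] p(3) q(3) by simp
qed

end

theorem theorem37:
  fixes P :: "ennreal measure" and \<mu>s :: "ereal measure"
  assumes "prob_space P" and "sets P = sets borel"
    and "symmetric_dist \<mu>s"
  shows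
    "(\<forall>\<mu> \<nu>. BP_fixed_point P \<mu>s \<mu> \<and> \<mu> \<noteq> trivial_dist \<and>
            BP_fixed_point P \<mu>s \<nu> \<and> \<nu> \<noteq> trivial_dist \<longrightarrow> \<mu> = \<nu>) \<and>
     (\<forall>\<mu>. BP_fixed_point P \<mu>s \<mu> \<and> \<mu> \<noteq> trivial_dist \<longrightarrow> symmetric_dist \<mu>) \<and>
     ((\<exists>\<mu>. BP_fixed_point P \<mu>s \<mu> \<and> symmetric_dist \<mu> \<and> \<mu> \<noteq> trivial_dist) \<longleftrightarrow>
        1 < (\<integral>\<^sup>+ d. d \<partial>P) \<or> \<mu>s \<noteq> trivial_dist) \<and>
     (\<forall>\<mu>. LLR_dist \<mu> \<and> \<mu> \<noteq> trivial_dist \<longrightarrow>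
        (\<forall>\<nu>. BP_fixed_point P \<mu>s \<nu> \<and> \<nu> \<noteq> trivial_dist \<longrightarrow>
            weak_conv_llr (\<lambda>h. (Q_L P \<mu>s ^^ h) \<mu>) \<nu>) \<and>
        ((\<nexists>\<nu>. BP_fixed_point P \<mu>s \<nu> \<and> \<nu> \<noteq> trivial_dist) \<longrightarrow>
            weak_conv_llr (\<lambda>h. (Q_L P \<mu>s ^^ h) \<mu>) trivial_dist)) \<and>
     (\<mu>s \<noteq> trivial_dist \<longrightarrow>
        (\<forall>\<nu>. BP_fixed_point P \<mu>s \<nu> \<and> \<nu> \<noteq> trivial_dist \<longrightarrow>
            weak_conv_llr (\<lambda>h. (Q_L P \<mu>s ^^ h) trivial_dist) \<nu>) \<and>
        ((\<nexists>\<nu>. BP_fixed_point P \<mu>s \<nu> \<and> \<nu> \<noteq> trivial_dist) \<longrightarrow>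
            weak_conv_llr (\<lambda>h. (Q_L P \<mu>s ^^ h) trivial_dist) trivial_dist))"
proof -
  interpret large_degree_bp P \<mu>s by (rule large_degree_bp.intro) (fact assms)+
  show ?thesis
  proof (intro conjI allI impI; (elim conjE)?)
    show "\<mu> = \<nu>" if "BP_fixed_point P \<mu>s \<mu>" "\<mu> \<noteq> trivial_dist"
      "BP_fixed_point P \<mu>s \<nu>" "\<nu> \<noteq> trivial_dist" for \<mu> \<nu>
      using that by (rule nontrivial_fixed_point_unique)
    show "symmetric_dist \<mu>" if "BP_fixed_point P \<mu>s \<mu>" for \<mu>
      using that by (rule symmetric_fixed_point)
    show "(\<exists>\<mu>. BP_fixed_point P \<mu>s \<mu> \<and> symmetric_dist \<mu> \<and> \<mu> \<noteq> trivial_dist)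
        \<longleftrightarrow> 1 < (\<integral>\<^sup>+d. d \<partial>P) \<or> \<mu>s \<noteq> trivial_dist"
      by (rule nontrivial_fixed_point_exists_iff)
    show "weak_conv_llr (\<lambda>h. (Q_L P \<mu>s ^^ h) \<mu>) \<nu>"
      if "LLR_dist \<mu>" "\<mu> \<noteq> trivial_dist" "BP_fixed_point P \<mu>s \<nu>" "\<nu> \<noteq> trivial_dist" for \<mu> \<nu>
      using that by (rule weak_conv_fixed)
    show "weak_conv_llr (\<lambda>h. (Q_L P \<mu>s ^^ h) \<mu>) trivial_dist"
      if "LLR_dist \<mu>" "\<mu> \<noteq> trivial_dist" "\<nexists>\<nu>. BP_fixed_point P \<mu>s \<nu> \<and> \<nu> \<noteq> trivial_dist" for \<mu>
      using that by (rule weak_conv_trivial)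
    show "weak_conv_llr (\<lambda>h. (Q_L P \<mu>s ^^ h) trivial_dist) \<nu>"
      if "\<mu>s \<noteq> trivial_dist" "BP_fixed_point P \<mu>s \<nu>" "\<nu> \<noteq> trivial_dist" for \<nu>
      using that by (rule weak_conv_from_trivial)
    \<comment> \<open>This case is vacuous: a non-trivial \<open>\<mu>s\<close> guarantees a
      non-trivial fixed point.\<close>
    show "weak_conv_llr (\<lambda>h. (Q_L P \<mu>s ^^ h) trivial_dist) trivial_dist"
      if s: "\<mu>s \<noteq> trivial_dist" and no: "\<nexists>\<nu>. BP_fixed_point P \<mu>s \<nu> \<and> \<nu> \<noteq> trivial_dist"
    proof -
      obtain \<nu> where "BP_fixed_point P \<mu>s \<nu>" "\<nu> \<noteq> trivial_dist"
        using nontrivial_fixed_point_exists_iff s by blast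
      with no show ?thesis by blast
    qed
  qed
qed

end
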